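(* Let $A$ be an indecomposable rational function of degree $n\geq 2$ (over $\mathbb{C}$) that is not conjugate to $z^{n}$ or to $z^{-n}$. Then $\Sigma_\infty(A)=\Sigma(A)$ whenever the group $\widehat G(A)$ is trivial. Moreover, the group $\Sigma_\infty(A)$ is trivial whenever $G(A)=\mathrm{Aut}(A)$.
   Context: Rational functions are viewed as holomorphic maps $\mathbb{CP}^1\to\mathbb{CP}^1$, and $A^{\circ k}$ denotes the $k$-th iterate of $A$. "Conjugate" means conjugate by a Möbius transformation. A rational function is indecomposable if it cannot be represented as a composition of two rational functions each of degree at least two. For a rational function $F$ of degree at least two: $G(F)$ is the group of all Möbius transformations $\sigma$ such that $F\circ\sigma=\nu_\sigma\circ F$ for some (necessarily unique) Möbius transformation $\nu_\sigma$; $\widehat G(F)$ is the image of the homomorphism $G(F)\to\mathrm{Aut}(\mathbb{CP}^1)$, $\sigma\mapsto\nu_\sigma$; $\Sigma(F)$ is the group of Möbius $\sigma$ with $F\circ\sigma=F$; $\mathrm{Aut}(F)$ is the group of Möbius $\sigma$ with $F\circ\sigma=\sigma\circ F$. Define $\Sigma_\infty(A)=\bigcup_{k=1}^\infty\Sigma(A^{\circ k})$. *)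

theory Defs
  imports Complex_Main "HOL-Computational_Algebra.Computational_Algebra"
begin

text \<open>The complex projective line as the one-point compactification of the complex plane:
  \<open>None\<close> is the point at infinity.\<close>

type_synonym cp1 = "complex option"

text \<open>The point with homogeneous coordinates \<open>[x : y]\<close>, meaningful for \<open>(x, y) \<noteq> (0, 0)\<close>.\<close>

definition hom_point :: "complex \<Rightarrow> complex \<Rightarrow> cp1" where
  "hom_point x y = (if y = 0 then None else Some (x / y))"

text \<open>The self-map of the projective line given by \<open>p / q\<close>, for coprime \<open>p\<close> and \<open>q\<close>. With
  \<open>n = max (degree p) (degree q)\<close>, its value at infinity is that of the homogenisation
  \<open>[y ^ n * p (x / y) : y ^ n * q (x / y)]\<close> at \<open>[1 : 0]\<close>. Coprimality ensures that the two
  coordinates never vanish simultaneously.\<close>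

definition quot_map :: "complex poly \<Rightarrow> complex poly \<Rightarrow> cp1 \<Rightarrow> cp1" where
  "quot_map p q w =
     (case w of
        Some z \<Rightarrow> hom_point (poly p z) (poly q z)
      | None \<Rightarrow> (let n = max (degree p) (degree q) in hom_point (coeff p n) (coeff q n)))"

text \<open>The degree is determined by the map, since a reduced fraction \<open>p / q\<close> is unique up to a
  common nonzero constant factor. The constant map to infinity (\<open>p = 1\<close>, \<open>q = 0\<close>) counts as
  rational of degree 0.\<close>

definition rational_of_degree :: "(cp1 \<Rightarrow> cp1) \<Rightarrow> nat \<Rightarrow> bool" where
  "rational_of_degree F n \<longleftrightarrow>
     (\<exists>p q. coprime p q \<and> F = quot_map p q \<and> n = max (degree p) (degree q))"

definition moebius :: "(cp1 \<Rightarrow> cp1) \<Rightarrow> bool" where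
  "moebius \<sigma> \<longleftrightarrow> (\<exists>a b c d. a * d - b * c \<noteq> 0 \<and> \<sigma> = quot_map [:b, a:] [:d, c:])"

definition indecomposable :: "(cp1 \<Rightarrow> cp1) \<Rightarrow> bool" where
  "indecomposable F \<longleftrightarrow>
     \<not> (\<exists>B C k l. rational_of_degree B k \<and> rational_of_degree C l \<and> k \<ge> 2 \<and> l \<ge> 2 \<and> F = B \<circ> C)"

definition conjugate :: "(cp1 \<Rightarrow> cp1) \<Rightarrow> (cp1 \<Rightarrow> cp1) \<Rightarrow> bool" where
  "conjugate F H \<longleftrightarrow> (\<exists>\<mu>. moebius \<mu> \<and> F = \<mu> \<circ> H \<circ> inv \<mu>)"

definition pow_map :: "nat \<Rightarrow> cp1 \<Rightarrow> cp1" where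
  "pow_map n = quot_map (monom 1 n) 1"

definition inv_pow_map :: "nat \<Rightarrow> cp1 \<Rightarrow> cp1" where
  "inv_pow_map n = quot_map 1 (monom 1 n)"

definition G_grp :: "(cp1 \<Rightarrow> cp1) \<Rightarrow> (cp1 \<Rightarrow> cp1) set" where
  "G_grp F = {\<sigma>. moebius \<sigma> \<and> (\<exists>\<nu>. moebius \<nu> \<and> F \<circ> \<sigma> = \<nu> \<circ> F)}"

text \<open>The transformation below is unique when \<open>\<sigma> \<in> G_grp F\<close> and \<open>F\<close> is nonconstant, because
  such an \<open>F\<close> is surjective.\<close>

definition nu_map :: "(cp1 \<Rightarrow> cp1) \<Rightarrow> (cp1 \<Rightarrow> cp1) \<Rightarrow> (cp1 \<Rightarrow> cp1)" where
  "nu_map F \<sigma> = (THE \<nu>. moebius \<nu> \<and> F \<circ> \<sigma> = \<nu> \<circ> F)"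

definition G_hat :: "(cp1 \<Rightarrow> cp1) \<Rightarrow> (cp1 \<Rightarrow> cp1) set" where
  "G_hat F = nu_map F ` G_grp F"

definition Sigma_grp :: "(cp1 \<Rightarrow> cp1) \<Rightarrow> (cp1 \<Rightarrow> cp1) set" where
  "Sigma_grp F = {\<sigma>. moebius \<sigma> \<and> F \<circ> \<sigma> = F}"

definition Aut_grp :: "(cp1 \<Rightarrow> cp1) \<Rightarrow> (cp1 \<Rightarrow> cp1) set" where
  "Aut_grp F = {\<sigma>. moebius \<sigma> \<and> F \<circ> \<sigma> = \<sigma> \<circ> F}"

definition Sigma_inf :: "(cp1 \<Rightarrow> cp1) \<Rightarrow> (cp1 \<Rightarrow> cp1) set" where
  "Sigma_inf F = (\<Union>k\<in>{1..}. Sigma_grp (F ^^ k))"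

end

theory Submission
  imports Defs "HOL-Computational_Algebra.Field_as_Ring"
begin

text \<open>Under either hypothesis \<open>\<Sigma>(A)\<close> is trivial. If \<open>G(A) = Aut(A)\<close>, then \<open>\<sigma> \<in> \<Sigma>(A)\<close> satisfies
  \<open>\<sigma> \<circ> A = A \<circ> \<sigma> = A\<close>; and if \<open>\<Sigma>(A)\<close> contains a nontrivial element, the indecomposable map \<open>A\<close>
  is a power map up to Moebius transformations on both sides, so that its group of \<open>\<nu>\<^sub>\<sigma>\<close> is infinite.

  For \<open>A \<circ> A ^^ k \<circ> \<sigma> = A \<circ> A ^^ k\<close> write \<open>h = A ^^ k \<circ> \<sigma>\<close>. Over the field generated by
  \<open>A ^^ k\<close>, hence over the one generated by \<open>A\<close>, the map \<open>h\<close> has degree at most \<open>n - 1\<close>, unless it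
  equals \<open>A ^^ k\<close>. As \<open>A\<close> is indecomposable, Lueroth's theorem puts \<open>h\<close> into the field generated by
  \<open>A\<close>, say \<open>h = h' \<circ> A\<close>, and \<open>A \<circ> A ^^ (k - 1) = A \<circ> h'\<close>. By descent \<open>h = \<nu> \<circ> A ^^ k\<close> with
  \<open>A \<circ> \<nu> = A\<close>. Since \<open>\<Sigma>(A)\<close> is trivial, \<open>\<nu>\<close> is the identity and \<open>\<sigma> \<in> \<Sigma>(A ^^ k)\<close>.\<close>

subsection \<open>Polynomials and linear systems\<close>

lemma degree_0_or_root:
  fixes p :: "'a::alg_closed_field poly"
  shows "degree p = 0 \<or> (\<exists>z. poly p z = 0)"
  using alg_closed_imp_poly_has_root[of p] by blast

lemma coprime_iff_no_common_root:
  fixes p q :: "complex poly"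
  shows "coprime p q \<longleftrightarrow> (\<forall>z. \<not> (poly p z = 0 \<and> poly q z = 0))"
proof
  assume "coprime p q"
  then show "\<forall>z. \<not> (poly p z = 0 \<and> poly q z = 0)"
    using coprime_poly_0 by blast
next
  assume nr: "\<forall>z. \<not> (poly p z = 0 \<and> poly q z = 0)"
  have "\<not> (\<exists>z. poly (gcd p q) z = 0)"
    using nr by (meson dvd_trans gcd_dvd1 gcd_dvd2 poly_eq_0_iff_dvd)
  then have "degree (gcd p q) = 0" "gcd p q \<noteq> 0"
    using degree_0_or_root[of "gcd p q"] by auto
  then have "is_unit (gcd p q)" by (subst is_unit_iff_degree) auto
  then show "coprime p q" by (simp only: is_unit_gcd)
qed

text \<open>Splitting off a root \<open>a\<close> leaves a cofactor that does not vanish at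
  \<open>a\<close> and is again square-free, so each step of the induction contributes exactly one
  new root.\<close>

lemma rsquarefree_card_roots:
  fixes p :: "complex poly"
  assumes "rsquarefree p"
  shows "card {z. poly p z = 0} = degree p"
  using assms
proof (induction "degree p" arbitrary: p)
  case 0
  then obtain c where "p = [:c:]" by (metis degree_eq_zeroE)
  moreover have "p \<noteq> 0" using 0 by (simp add: rsquarefree_def)
  ultimately show ?case by simp
next
  case (Suc n)
  then obtain a where a: "poly p a = 0" using degree_0_or_root[of p] by auto
  then obtain q where q: "p = [:-a, 1:] * q" by (metis dvdE poly_eq_0_iff_dvd)
  have "p \<noteq> 0" using Suc by auto
  then have q0: "q \<noteq> 0" using q by auto
  have dq: "degree q = n" using Suc.hyps(2) degree_mult_eq[of "[:-a, 1:]" q] q0 unfolding q by (simp del: mult_pCons_left)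
  have pd: "pderiv p = q + [:-a, 1:] * pderiv q"
    unfolding q pderiv_mult by (simp add: pderiv_pCons)
  have qa: "poly q a \<noteq> 0"
  proof
    assume "poly q a = 0"
    then have "poly (pderiv p) a = 0" by (simp add: pd)
    with a Suc.prems show False by (auto simp: rsquarefree_roots)
  qed
  have "rsquarefree q"
    unfolding rsquarefree_roots
  proof (intro allI notI)
    fix b assume "poly q b = 0 \<and> poly (pderiv q) b = 0"
    then have "poly p b = 0 \<and> poly (pderiv p) b = 0" unfolding pd by (simp add: q)
    with Suc.prems show False by (auto simp: rsquarefree_roots)
  qed
  then have "card {z. poly q z = 0} = n" using Suc.hyps(1) dq by blast
  moreover have "{z. poly p z = 0} = insert a {z. poly q z = 0}" by (auto simp: q)
  moreover have "finite {z. poly q z = 0}" using q0 by (rule poly_roots_finite)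
  ultimately show ?case using qa Suc.hyps(2) by simp
qed

lemma rsquarefree_dvd:
  fixes p q :: "complex poly"
  assumes "rsquarefree p" "q dvd p"
  shows "rsquarefree q"
proof -
  obtain k where "p = q * k" using assms(2) by (elim dvdE)
  then show ?thesis
    using assms(1) unfolding rsquarefree_roots by (auto simp: pderiv_mult)
qed

lemma coeff_mult_top:
  fixes p q :: "'a::comm_semiring_0 poly"
  assumes "degree p \<le> m" "degree q \<le> n"
  shows "coeff (p * q) (m + n) = coeff p m * coeff q n"
proof -
  have "coeff (p * q) (m + n) = (\<Sum>i\<le>m + n. coeff p i * coeff q (m + n - i))"
    by (rule coeff_mult)
  also have "\<dots> = (\<Sum>i\<in>{m}. coeff p i * coeff q (m + n - i))"
  proof (rule sum.mono_neutral_right)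
    show "\<forall>i\<in>{..m + n} - {m}. coeff p i * coeff q (m + n - i) = 0"
    proof
      fix i assume "i \<in> {..m + n} - {m}"
      then have "i > m \<or> m + n - i > n" by auto
      then show "coeff p i * coeff q (m + n - i) = 0"
        using assms by (auto simp: coeff_eq_0)
    qed
  qed auto
  finally show ?thesis by simp
qed

lemma coeff_power_top:
  fixes p :: "'a::comm_semiring_1 poly"
  assumes "degree p \<le> m"
  shows "coeff (p ^ i) (m * i) = coeff p m ^ i"
proof (induction i)
  case (Suc i)
  have "degree (p ^ i) \<le> m * i"
    using assms degree_power_le[of p i] by (meson le_trans mult_le_mono1)
  then have "coeff (p * p ^ i) (m + m * i) = coeff p m * coeff (p ^ i) (m * i)"
    by (rule coeff_mult_top[OF assms])
  then show ?case using Suc by simp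
qed simp

text \<open>Gaussian elimination: a nontrivial equation is solved for one unknown, which leaves a
  system with one equation and one unknown fewer.\<close>

lemma ex_nonzero_solution:
  fixes c :: "'j \<Rightarrow> 'i \<Rightarrow> 'a::field"
  assumes "finite J" "finite I" "card J < card I"
  shows "\<exists>x. (\<exists>i\<in>I. x i \<noteq> 0) \<and> (\<forall>j\<in>J. (\<Sum>i\<in>I. c j i * x i) = 0)"
  using assms
proof (induction J arbitrary: I c rule: finite_induct)
  case empty
  then obtain i where "i \<in> I" by fastforce
  then show ?case by (intro exI[of _ "\<lambda>_. 1"]) auto
next
  case (insert j J)
  show ?case
  proof (cases "\<forall>i\<in>I. c j i = 0")
    case True
    have "card J < card I" using insert by simp
    then obtain x where "\<exists>i\<in>I. x i \<noteq> 0" "\<forall>j\<in>J. (\<Sum>i\<in>I. c j i * x i) = 0"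
      using insert.IH insert.prems by blast
    then show ?thesis using True by (intro exI[of _ x]) auto
  next
    case False
    then obtain k where k: "k \<in> I" "c j k \<noteq> 0" by blast
    define I' where "I' = I - {k}"
    have I': "finite I'" "k \<notin> I'" "I = Set.insert k I'" "card J < card I'"
      using k insert by (auto simp: I'_def)
    \<comment> \<open>Coefficients of the other equations after the unknown \<open>k\<close> has
      been eliminated by means of equation \<open>j\<close>.\<close>
    define c' where "c' = (\<lambda>l i. c l i - c l k * c j i / c j k)"
    obtain x where x: "\<exists>i\<in>I'. x i \<noteq> 0" "\<forall>l\<in>J. (\<Sum>i\<in>I'. c' l i * x i) = 0"
      using insert.IH[of I' c'] I' by blast
    define s where "s = (\<Sum>i\<in>I'. c j i * x i)"
    \<comment> \<open>Back substitution: the value at \<open>k\<close> is the one forced by equation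
      \<open>j\<close>.\<close>
    define y where "y = x(k := - s / c j k)"
    have sum_y: "(\<Sum>i\<in>I. c l i * y i) = c l k * (- s / c j k) + (\<Sum>i\<in>I'. c l i * x i)" for l
    proof -
      have "(\<Sum>i\<in>I. c l i * y i) = c l k * y k + (\<Sum>i\<in>I'. c l i * y i)"
        unfolding I'(3) using I'(1,2) by simp
      also have "(\<Sum>i\<in>I'. c l i * y i) = (\<Sum>i\<in>I'. c l i * x i)"
        using I'(2) by (intro sum.cong) (auto simp: y_def)
      finally show ?thesis by (simp add: y_def)
    qed
    have "(\<Sum>i\<in>I. c l i * y i) = 0" if "l \<in> insert j J" for l
    proof (cases "l = j")
      case True
      then show ?thesis using k(2) unfolding sum_y by (simp add: s_def)
    next
      case False
      then have "(\<Sum>i\<in>I'. c' l i * x i) = 0" using x(2) that by blast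
      moreover have "(\<Sum>i\<in>I'. c' l i * x i) = (\<Sum>i\<in>I'. c l i * x i) - c l k / c j k * s"
        unfolding c'_def s_def sum_distrib_left sum_subtractf[symmetric]
        by (intro sum.cong) (auto simp: field_simps)
      ultimately show ?thesis unfolding sum_y by simp
    qed
    moreover have "\<exists>i\<in>I. y i \<noteq> 0" using x(1) I' by (auto simp: y_def)
    ultimately show ?thesis by blast
  qed
qed

subsection \<open>Composition of rational maps\<close>

text \<open>The homogenisation of \<open>p\<close> in the nominal degree \<open>N\<close>; it still
  makes sense at infinity, where \<open>y = 0\<close>.\<close>

definition hom_eval :: "'a::comm_semiring_1 poly \<Rightarrow> nat \<Rightarrow> 'a \<Rightarrow> 'a \<Rightarrow> 'a" where
  "hom_eval p N x y = (\<Sum>i\<le>N. coeff p i * x ^ i * y ^ (N - i))"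

lemma hom_eval_eq_poly:
  fixes p :: "'a::field poly"
  assumes "degree p \<le> N" "y \<noteq> 0"
  shows "hom_eval p N x y = y ^ N * poly p (x / y)"
proof -
  have "poly p (x / y) = (\<Sum>i\<le>N. coeff p i * (x / y) ^ i)"
    proof -
    have "poly p (x / y) = (\<Sum>i\<le>degree p. coeff p i * (x / y) ^ i)" by (rule poly_altdef)
    also have "\<dots> = (\<Sum>i\<le>N. coeff p i * (x / y) ^ i)"
      using assms(1) by (intro sum.mono_neutral_left) (auto simp: coeff_eq_0)
    finally show ?thesis .
  qed
  then have "y ^ N * poly p (x / y) = (\<Sum>i\<le>N. y ^ N * (coeff p i * (x / y) ^ i))"
    by (simp add: sum_distrib_left)
  also have "\<dots> = hom_eval p N x y"
    unfolding hom_eval_def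
  proof (intro sum.cong refl)
    fix i assume "i \<in> {..N}"
    then have "y ^ N = y ^ i * y ^ (N - i)" by (simp flip: power_add)
    then show "y ^ N * (coeff p i * (x / y) ^ i) = coeff p i * x ^ i * y ^ (N - i)"
      using assms(2) by (simp add: power_divide)
  qed
  finally show ?thesis by simp
qed

lemma hom_eval_infinity: "hom_eval p N x 0 = coeff p N * x ^ N"
proof -
  have "hom_eval p N x 0 = (\<Sum>i\<in>{N}. coeff p i * x ^ i * 0 ^ (N - i))"
    unfolding hom_eval_def by (intro sum.mono_neutral_right) (auto simp: power_0_left)
  then show ?thesis by simp
qed

lemma hom_eval_scale:
  "hom_eval p N (c * x) (c * y) = c ^ N * hom_eval p N x y" for x :: "'a::comm_semiring_1"
  unfolding hom_eval_def sum_distrib_left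
proof (intro sum.cong refl)
  fix i assume "i \<in> {..N}"
  then have "c ^ N = c ^ i * c ^ (N - i)" by (simp flip: power_add)
  then show "coeff p i * (c * x) ^ i * (c * y) ^ (N - i) = c ^ N * (coeff p i * x ^ i * y ^ (N - i))"
    by (simp add: power_mult_distrib algebra_simps)
qed

text \<open>This is \<open>v ^ N * p (u / v)\<close>, the numerator of a composition after clearing
  denominators.\<close>

definition hom_comp :: "complex poly \<Rightarrow> nat \<Rightarrow> complex poly \<Rightarrow> complex poly \<Rightarrow> complex poly" where
  "hom_comp p N u v = (\<Sum>i\<le>N. smult (coeff p i) (u ^ i * v ^ (N - i)))"

lemma poly_hom_comp: "poly (hom_comp p N u v) z = hom_eval p N (poly u z) (poly v z)"
  by (simp add: hom_comp_def hom_eval_def poly_sum mult.assoc)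

lemma degree_hom_comp_le:
  assumes "degree u \<le> l" "degree v \<le> l"
  shows "degree (hom_comp p N u v) \<le> l * N"
  unfolding hom_comp_def
proof (intro degree_sum_le)
  fix i assume "i \<in> {..N}"
  have "degree (u ^ i) \<le> l * i" "degree (v ^ (N - i)) \<le> l * (N - i)"
    using assms degree_power_le[of u i] degree_power_le[of v "N - i"]
    by (meson le_trans mult_le_mono1)+
  then have "degree (u ^ i * v ^ (N - i)) \<le> l * i + l * (N - i)"
    by (meson add_mono degree_mult_le le_trans)
  also have "\<dots> = l * N" using \<open>i \<in> {..N}\<close> by (simp flip: distrib_left)
  finally show "degree (smult (coeff p i) (u ^ i * v ^ (N - i))) \<le> l * N"
    by (meson degree_smult_le le_trans)
qed simp

text \<open>Coefficients in the nominal top degree carry the value at infinity, so this computes a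
  composition there.\<close>

lemma coeff_hom_comp:
  assumes "degree u \<le> l" "degree v \<le> l"
  shows "coeff (hom_comp p N u v) (l * N) = hom_eval p N (coeff u l) (coeff v l)"
  unfolding hom_comp_def hom_eval_def coeff_sum coeff_smult mult.assoc
proof (intro sum.cong refl arg_cong2[where f = times])
  fix i assume i: "i \<in> {..N}"
  have "degree (u ^ i) \<le> l * i" "degree (v ^ (N - i)) \<le> l * (N - i)"
    using assms degree_power_le[of u i] degree_power_le[of v "N - i"]
    by (meson le_trans mult_le_mono1)+
  then have "coeff (u ^ i * v ^ (N - i)) (l * i + l * (N - i)) =
      coeff (u ^ i) (l * i) * coeff (v ^ (N - i)) (l * (N - i))"
    by (rule coeff_mult_top)
  also have "l * i + l * (N - i) = l * N" using i by (simp flip: distrib_left)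
  finally show "coeff (u ^ i * v ^ (N - i)) (l * N) = coeff u l ^ i * coeff v l ^ (N - i)"
    using assms by (simp add: coeff_power_top)
qed

lemma hom_point_scale: "c \<noteq> 0 \<Longrightarrow> hom_point (c * x) (c * y) = hom_point x y"
  by (simp add: hom_point_def)

lemma hom_point_eq_iff:
  assumes "(x, y) \<noteq> (0, 0)" "(x', y') \<noteq> (0, 0)"
  shows "hom_point x y = hom_point x' y' \<longleftrightarrow> x * y' = x' * y"
  using assms by (auto simp: hom_point_def field_simps)

lemma hom_point_cases:
  obtains x y where "w = hom_point x y" "(x, y) \<noteq> (0, 0)"
proof (cases w)
  case None
  then have "w = hom_point 1 0" by (simp add: hom_point_def)
  then show ?thesis using that by fastforce
next
  case (Some z)
  then have "w = hom_point z 1" by (simp add: hom_point_def)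
  then show ?thesis using that by fastforce
qed

text \<open>At infinity one of the two top coefficients survives; at finite points \<open>p\<close>
  and \<open>q\<close> have no common root.\<close>

lemma hom_eval_nonzero:
  fixes p q :: "complex poly"
  assumes "coprime p q" "N = max (degree p) (degree q)" "(x, y) \<noteq> (0, 0)"
  shows "(hom_eval p N x y, hom_eval q N x y) \<noteq> (0, 0)"
proof (cases "y = 0")
  case True
  have "coeff p N \<noteq> 0 \<or> coeff q N \<noteq> 0"
  proof (rule ccontr)
    assume "\<not> ?thesis"
    then have *: "coeff p N = 0" "coeff q N = 0" by auto
    then have "p = 0 \<or> q = 0"
      using assms(2) by (metis leading_coeff_0_iff max_def)
    then have "p = 0 \<and> q = 0"
      using * assms(2) by (metis degree_0 leading_coeff_0_iff max_0L max_0R)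
    then show False using assms(1) by simp
  qed
  then show ?thesis using True assms(3) by (auto simp: hom_eval_infinity)
next
  case False
  have "degree p \<le> N" "degree q \<le> N" using assms(2) by auto
  then show ?thesis
    using False assms(1) by (auto simp: hom_eval_eq_poly coprime_iff_no_common_root)
qed

lemma quot_map_hom_point:
  assumes "N = max (degree p) (degree q)" "(x, y) \<noteq> (0, 0)"
  shows "quot_map p q (hom_point x y) = hom_point (hom_eval p N x y) (hom_eval q N x y)"
proof (cases "y = 0")
  case True
  then have "hom_point x y = None" "x ^ N \<noteq> 0" using assms(2) by (auto simp: hom_point_def)
  then show ?thesis
    using True assms(1) hom_point_scale[of "x ^ N" "coeff p N" "coeff q N"]
    by (simp add: hom_eval_infinity quot_map_def Let_def mult.commute)
next
  case False
  have "degree p \<le> N" "degree q \<le> N" using assms(1) by auto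
  moreover have "hom_point x y = Some (x / y)" using False by (simp add: hom_point_def)
  ultimately show ?thesis
    using False by (simp add: hom_eval_eq_poly quot_map_def hom_point_scale)
qed

lemma quot_map_Some: "quot_map p q (Some z) = hom_point (poly p z) (poly q z)"
  by (simp add: quot_map_def)

lemma quot_map_None:
  "quot_map p q None = hom_point (coeff p (max (degree p) (degree q))) (coeff q (max (degree p) (degree q)))"
  by (simp add: quot_map_def Let_def)

lemma coprime_poly_nonzero:
  fixes p q :: "complex poly"
  shows "coprime p q \<Longrightarrow> (poly p z, poly q z) \<noteq> (0, 0)"
  using coprime_iff_no_common_root by auto

lemma coprime_top_coeff_nonzero:
  fixes p q :: "complex poly"
  assumes "coprime p q" "n = max (degree p) (degree q)"
  shows "(coeff p n, coeff q n) \<noteq> (0, 0)"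
  using hom_eval_nonzero[OF assms, of 1 0] by (simp add: hom_eval_infinity)

text \<open>The homogenised pair never vanishes. At finite points this rules out a common root of
  \<open>P\<close> and \<open>Q\<close>; at infinity it keeps one of their coefficients in degree
  \<open>N * l\<close> nonzero.\<close>

lemma quot_map_comp:
  assumes "coprime p q" "N = max (degree p) (degree q)"
    and "coprime u v" "l = max (degree u) (degree v)"
  defines "P \<equiv> hom_comp p N u v" and "Q \<equiv> hom_comp q N u v"
  shows "coprime P Q" and "max (degree P) (degree Q) = N * l"
    and "quot_map p q \<circ> quot_map u v = quot_map P Q"
proof -
  show cop: "coprime P Q"
    unfolding coprime_iff_no_common_root
  proof (intro allI notI)
    fix z assume "poly P z = 0 \<and> poly Q z = 0"
    then show False
      using hom_eval_nonzero[OF assms(1,2) coprime_poly_nonzero[OF assms(3)], of z]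
      by (simp add: P_def Q_def poly_hom_comp)
  qed
  have dl: "degree u \<le> l" "degree v \<le> l" using assms(4) by auto
  have le: "degree P \<le> N * l" "degree Q \<le> N * l"
    unfolding P_def Q_def using degree_hom_comp_le[OF dl] by (simp_all add: mult.commute)
  have cf: "coeff P (N * l) = hom_eval p N (coeff u l) (coeff v l)"
    "coeff Q (N * l) = hom_eval q N (coeff u l) (coeff v l)"
    unfolding P_def Q_def using coeff_hom_comp[OF dl] by (simp_all add: mult.commute)
  have nz: "(coeff u l, coeff v l) \<noteq> (0, 0)"
    using assms(3,4) by (rule coprime_top_coeff_nonzero)
  have "(coeff P (N * l), coeff Q (N * l)) \<noteq> (0, 0)"
    unfolding cf by (rule hom_eval_nonzero[OF assms(1,2) nz])
  then have "N * l \<le> degree P \<or> N * l \<le> degree Q"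
    by (auto intro: le_degree)
  then show mx: "max (degree P) (degree Q) = N * l" using le by auto
  show "quot_map p q \<circ> quot_map u v = quot_map P Q"
  proof
    fix w show "(quot_map p q \<circ> quot_map u v) w = quot_map P Q w"
    proof (cases w)
      case None
      then show ?thesis
        using quot_map_hom_point[OF assms(2) nz] mx cf assms(4)
        by (simp add: quot_map_None)
    next
      case (Some z)
      then show ?thesis
        using quot_map_hom_point[OF assms(2) coprime_poly_nonzero[OF assms(3)]]
        by (simp add: quot_map_Some P_def Q_def poly_hom_comp)
    qed
  qed
qed

lemma rational_comp:
  assumes "rational_of_degree B k" "rational_of_degree C l"
  shows "rational_of_degree (B \<circ> C) (k * l)"
  using assms unfolding rational_of_degree_def using quot_map_comp by metis

subsection \<open>General fibres\<close>

lemma MOST_poly_nonzero: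
  fixes p :: "'a::idom poly"
  assumes "p \<noteq> 0"
  shows "\<forall>\<^sub>\<infinity>z. poly p z \<noteq> 0"
  unfolding eventually_cofinite using poly_roots_finite[OF assms] by simp

text \<open>General points are those outside a finite set, so the single point at infinity may be
  ignored.\<close>

lemma MOST_option_iff: "(\<forall>\<^sub>\<infinity>w::'a option. P w) \<longleftrightarrow> (\<forall>\<^sub>\<infinity>z. P (Some z))"
proof -
  have "{w. \<not> P w} \<subseteq> insert None (Some ` {z. \<not> P (Some z)})"
    by (auto simp: image_iff) (metis not_None_eq)
  moreover have "Some ` {z. \<not> P (Some z)} \<subseteq> {w. \<not> P w}" by auto
  ultimately show ?thesis
    unfolding eventually_cofinite
    by (meson finite.insertI finite_imageD finite_imageI finite_subset inj_Some)
qed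

lemma infinite_UNIV_cp1 [simp]: "infinite (UNIV :: cp1 set)"
  by (simp add: infinite_UNIV_char_0)

lemma MOST_cp1_ex: "\<forall>\<^sub>\<infinity>w::cp1. P w \<Longrightarrow> \<exists>w. P w"
  using MOST_INFM[OF infinite_UNIV_cp1] INFM_EX by blast

lemma MOST_complex_ex: "\<forall>\<^sub>\<infinity>w::complex. P w \<Longrightarrow> \<exists>w. P w"
  using MOST_INFM[OF infinite_UNIV_char_0] INFM_EX by blast

text \<open>Agreement at infinitely many points forces \<open>p * q' = p' * q\<close>; its top
  coefficients then carry the equality over to infinity.\<close>

lemma quot_map_eqI:
  assumes "coprime p q" "coprime p' q'"
    and "\<exists>\<^sub>\<infinity>w. quot_map p q w = quot_map p' q' w"
  shows "quot_map p q = quot_map p' q'"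
proof -
  have iff: "quot_map p q (Some z) = quot_map p' q' (Some z) \<longleftrightarrow> poly (p * q' - p' * q) z = 0" for z
    unfolding quot_map_Some
    by (subst hom_point_eq_iff[OF coprime_poly_nonzero[OF assms(1)] coprime_poly_nonzero[OF assms(2)]])
      simp
  have "\<not> (\<forall>\<^sub>\<infinity>w. quot_map p q w \<noteq> quot_map p' q' w)"
    using assms(3) unfolding frequently_def .
  then have "\<not> (\<forall>\<^sub>\<infinity>z. poly (p * q' - p' * q) z \<noteq> 0)"
    unfolding MOST_option_iff iff .
  then have "p * q' - p' * q = 0"
    using MOST_poly_nonzero[of "p * q' - p' * q"] by blast
  then have eq: "p * q' = p' * q" by simp
  \<comment> \<open>The two nominal degrees are not known to agree, so the products are compared in
    degree \<open>m + n\<close>.\<close>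
  define m n where "m = max (degree p) (degree q)" and "n = max (degree p') (degree q')"
  have "coeff (p * q') (m + n) = coeff p m * coeff q' n"
    "coeff (q * p') (m + n) = coeff q m * coeff p' n"
    by (rule coeff_mult_top; simp add: m_def n_def)+
  then have "coeff p m * coeff q' n = coeff p' n * coeff q m"
    by (simp add: eq mult.commute)
  then have "quot_map p q None = quot_map p' q' None"
    unfolding quot_map_None m_def[symmetric] n_def[symmetric]
    by (subst hom_point_eq_iff[OF coprime_top_coeff_nonzero[OF assms(1) m_def]
          coprime_top_coeff_nonzero[OF assms(2) n_def]])
  then show ?thesis
    using iff eq by (metis diff_self ext option.exhaust poly_0)
qed

lemma rational_eqI:
  assumes "rational_of_degree F m" "rational_of_degree G n" "\<exists>\<^sub>\<infinity>w. F w = G w"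
  shows "F = G"
  using assms quot_map_eqI unfolding rational_of_degree_def by metis

lemma quot_map_fibre_Some:
  assumes "coprime p q"
  shows "quot_map p q (Some z) = Some t \<longleftrightarrow> poly (p - smult t q) z = 0"
proof -
  have "Some t = hom_point t 1" by (simp add: hom_point_def)
  then show ?thesis
    using hom_point_eq_iff[OF coprime_poly_nonzero[OF assms], of t 1 z]
    by (simp add: quot_map_Some)
qed

lemma quot_map_fibre_None:
  "quot_map p q (Some z) = None \<longleftrightarrow> poly q z = 0"
  by (simp add: quot_map_Some hom_point_def)

text \<open>A root of the pencil member \<open>p - smult t q\<close> escapes to infinity exactly
  when its degree drops below the nominal one.\<close>

lemma quot_map_None_eq_Some:
  assumes "coprime p q"
  shows "quot_map p q None = Some t \<longleftrightarrow>
    coeff (p - smult t q) (max (degree p) (degree q)) = 0"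
proof -
  have "Some t = hom_point t 1" by (simp add: hom_point_def)
  then show ?thesis
    using hom_point_eq_iff[OF coprime_top_coeff_nonzero[OF assms refl], of t 1]
    by (simp add: quot_map_None)
qed

lemma pencil_nonzero:
  fixes p q :: "complex poly"
  assumes "coprime p q" "max (degree p) (degree q) \<ge> 1"
  shows "p - smult t q \<noteq> 0" and "q \<noteq> 0"
proof -
  show "q \<noteq> 0"
  proof
    assume "q = 0"
    then have "is_unit p" using assms(1) by simp
    then have "degree p = 0" using is_unit_iff_degree by (metis degree_0)
    with \<open>q = 0\<close> assms(2) show False by simp
  qed
  show "p - smult t q \<noteq> 0"
  proof
    assume "p - smult t q = 0"
    then have "p = smult t q" by simp
    then have "q dvd p" by (simp add: dvd_smult)
    then have "is_unit q" using assms(1) by (metis coprime_def dvd_refl)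
    then have "degree q = 0" using is_unit_iff_degree by (metis degree_0)
    then have "degree p = 0" using \<open>p = smult t q\<close> by (metis degree_smult_le le_zero_eq)
    with \<open>degree q = 0\<close> assms(2) show False by simp
  qed
qed

text \<open>If the Wronskian vanished, coprimality would make \<open>p\<close> and \<open>q\<close>
  divide their own derivatives, so both would be constant. Its finitely many zeros are the finite
  critical points.\<close>

lemma wronskian_nonzero:
  fixes p q :: "complex poly"
  assumes "coprime p q" "max (degree p) (degree q) \<ge> 1"
  shows "pderiv p * q - p * pderiv q \<noteq> 0"
proof
  assume "pderiv p * q - p * pderiv q = 0"
  then have eq: "pderiv p * q = p * pderiv q" by simp
  have "p dvd pderiv p" using assms(1) eq by (metis coprime_dvd_mult_left_iff dvd_triv_left)
  moreover have "q dvd pderiv q"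
    using assms(1) eq by (metis coprime_commute coprime_dvd_mult_right_iff dvd_triv_right)
  ultimately show False using assms(2) by simp
qed

locale nonconstant_rational =
  fixes F :: "cp1 \<Rightarrow> cp1" and n :: nat
  assumes rational: "rational_of_degree F n" and pos: "n \<ge> 1"
begin

lemma finite_fibre: "finite (F -` {t})"
proof -
  obtain p q where pq: "coprime p q" "F = quot_map p q" "n = max (degree p) (degree q)"
    using rational unfolding rational_of_degree_def by blast
  have nz: "p - smult s q \<noteq> 0" "q \<noteq> 0" for s using pencil_nonzero[OF pq(1)] pos pq(3) by auto
  have "finite {z. F (Some z) = t}"
  proof (cases t)
    case None
    then show ?thesis
      using poly_roots_finite[OF nz(2)] by (simp add: pq(2) quot_map_fibre_None)
  next
    case (Some s)
    then show ?thesis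
      using poly_roots_finite[OF nz(1)[of s]] by (simp add: pq(2) quot_map_fibre_Some[OF pq(1)])
  qed
  moreover have "F -` {t} \<subseteq> insert None (Some ` {z. F (Some z) = t})"
  proof
    fix w assume "w \<in> F -` {t}"
    then show "w \<in> insert None (Some ` {z. F (Some z) = t})" by (cases w) auto
  qed
  ultimately show ?thesis by (meson finite.insertI finite_imageI finite_subset)
qed

text \<open>A pencil member without roots is constant, hence its coefficient in degree
  \<open>n\<close> vanishes and infinity takes the value.\<close>

lemma surj: "surj F"
proof -
  obtain p q where pq: "coprime p q" "F = quot_map p q" "n = max (degree p) (degree q)"
    using rational unfolding rational_of_degree_def by blast
  have "\<exists>w. F w = t" for t
  proof (cases t)
    case None
    show ?thesis
    proof (cases "degree q = 0")
      case True
      then have "coeff q n = 0" using pos pq(3) by (intro coeff_eq_0) auto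
      then have "F None = None" by (simp add: pq quot_map_None hom_point_def)
      then show ?thesis using None by blast
    next
      case False
      then show ?thesis
        using degree_0_or_root[of q] None quot_map_fibre_None pq(2) by metis
    qed
  next
    case (Some s)
    show ?thesis
    proof (cases "degree (p - smult s q) = 0")
      case True
      then have "coeff (p - smult s q) n = 0" using pos by (intro coeff_eq_0) auto
      then have "F None = Some s" using quot_map_None_eq_Some[OF pq(1)] pq by simp
      then show ?thesis using Some by blast
    next
      case False
      then show ?thesis
        using degree_0_or_root[of "p - smult s q"] Some quot_map_fibre_Some[OF pq(1)] pq(2) by metis
    qed
  qed
  then show ?thesis by (metis surjI)
qed

lemma MOST_vimage:
  assumes "\<forall>\<^sub>\<infinity>t. P t"
  shows "\<forall>\<^sub>\<infinity>w. P (F w)"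
proof -
  have "{w. \<not> P (F w)} = (\<Union>t\<in>{t. \<not> P t}. F -` {t})" by auto
  then show ?thesis using assms finite_fibre by (simp add: eventually_cofinite)
qed

lemma MOST_fibre:
  assumes "\<forall>\<^sub>\<infinity>w. P w"
  shows "\<forall>\<^sub>\<infinity>t. \<forall>w. F w = t \<longrightarrow> P w"
proof -
  have "{t. \<not> (\<forall>w. F w = t \<longrightarrow> P w)} = F ` {w. \<not> P w}" by auto
  then show ?thesis using assms by (simp add: eventually_cofinite)
qed

lemma MOST_same_fibre:
  assumes "\<forall>\<^sub>\<infinity>w. P w"
  shows "\<forall>\<^sub>\<infinity>w. \<forall>w'. F w' = F w \<longrightarrow> P w'"
  using MOST_vimage[OF MOST_fibre[OF assms]] by simp

text \<open>Outside the images of infinity and of the critical points, the pencil member has full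
  degree and only simple roots.\<close>

lemma MOST_card_fibre: "\<forall>\<^sub>\<infinity>t. card (F -` {t}) = n"
proof -
  obtain p q where pq: "coprime p q" "F = quot_map p q" "n = max (degree p) (degree q)"
    using rational unfolding rational_of_degree_def by blast
  \<comment> \<open>Demanding \<open>w = Some z\<close> also removes the value at infinity.\<close>
  have "\<forall>\<^sub>\<infinity>w. \<exists>z. w = Some z \<and> poly (pderiv p * q - p * pderiv q) z \<noteq> 0"
    unfolding MOST_option_iff
    using MOST_poly_nonzero[OF wronskian_nonzero[OF pq(1)]] pos pq(3) by simp
  from MOST_fibre[OF this]
  have "\<forall>\<^sub>\<infinity>t. t \<noteq> None \<and> (\<forall>w. F w = t \<longrightarrow> (\<exists>z. w = Some z \<and> poly (pderiv p * q - p * pderiv q) z \<noteq> 0))"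
    by (rule MOST_conjI[OF MOST_neq(1)])
  then show ?thesis
  proof (rule MOST_mono)
    fix t
    assume t: "t \<noteq> None \<and> (\<forall>w. F w = t \<longrightarrow> (\<exists>z. w = Some z \<and> poly (pderiv p * q - p * pderiv q) z \<noteq> 0))"
    then obtain s where s: "t = Some s" by auto
    define R where "R = p - smult s q"
    have "F None \<noteq> Some s" using t s by fastforce
    then have "coeff R n \<noteq> 0"
      using quot_map_None_eq_Some[OF pq(1)] pq by (simp add: R_def)
    moreover have "degree R \<le> n" unfolding R_def pq(3)
      by (intro degree_diff_le order.trans[OF degree_smult_le]) auto
    ultimately have dR: "degree R = n" using le_degree by (metis le_antisym)
    have "rsquarefree R"
      unfolding rsquarefree_roots
    proof (intro allI notI)
      fix z assume z: "poly R z = 0 \<and> poly (pderiv R) z = 0"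
      then have "F (Some z) = t" using quot_map_fibre_Some[OF pq(1)] by (simp add: pq(2) s R_def)
      then have "poly (pderiv p * q - p * pderiv q) z \<noteq> 0" using t by blast
      moreover have "poly p z = s * poly q z" "poly (pderiv p) z = s * poly (pderiv q) z"
        using z by (simp_all add: R_def pderiv_diff pderiv_smult)
      ultimately show False by simp
    qed
    then have "card {z. poly R z = 0} = n" using rsquarefree_card_roots dR by blast
    moreover have "F -` {t} = Some ` {z. poly R z = 0}"
    proof (intro set_eqI iffI)
      fix w assume "w \<in> F -` {t}"
      then obtain z where "w = Some z" "F (Some z) = t" using t by auto
      then show "w \<in> Some ` {z. poly R z = 0}"
        using quot_map_fibre_Some[OF pq(1)] by (simp add: pq(2) s R_def)
    next
      fix w assume "w \<in> Some ` {z. poly R z = 0}"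
      then show "w \<in> F -` {t}"
        using quot_map_fibre_Some[OF pq(1)] by (auto simp add: pq(2) s R_def)
    qed
    ultimately show "card (F -` {t}) = n" by (simp add: card_image)
  qed
qed

end

section \<open>Uniqueness of the degree, and left factors\<close>

text \<open>A positive degree is the size of the general fibre; a map of degree \<open>0\<close> has
  a one-point range and cannot be onto.\<close>

lemma rational_degree_unique:
  assumes "rational_of_degree F m" "rational_of_degree F n"
  shows "m = n"
proof -
  have *: "m = n" if mn: "m \<ge> 1" "rational_of_degree F m" "rational_of_degree F n" for m n
  proof -
    interpret M: nonconstant_rational F m using mn by unfold_locales
    show ?thesis
    proof (cases "n = 0")
      case True
      then obtain p q where pq: "F = quot_map p q" "max (degree p) (degree q) = 0"
        using mn(3) unfolding rational_of_degree_def by metis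
      then have "degree p = 0" "degree q = 0" by linarith+
      with pq(1) obtain a b where "F = quot_map [:a:] [:b:]" by (metis degree_eq_zeroE)
      then have "F w = hom_point a b" for w by (cases w) (auto simp: quot_map_Some quot_map_None)
      then have "range F = {hom_point a b}" by auto
      then have "finite (UNIV :: cp1 set)" using M.surj by (metis finite.emptyI finite.insertI)
      then show ?thesis using infinite_UNIV_cp1 by blast
    next
      case False
      interpret N: nonconstant_rational F n using mn False by unfold_locales auto
      show ?thesis
        using MOST_cp1_ex[OF MOST_conjI[OF M.MOST_card_fibre N.MOST_card_fibre]] by auto
    qed
  qed
  show ?thesis
    using *[of m n] *[of n m] assms by (cases "m = 0"; cases "n = 0") auto
qed

lemma hom_point_eq_imp_scale:
  assumes "hom_point x y = hom_point x' y'" "(x, y) \<noteq> (0, 0)" "(x', y') \<noteq> (0, 0)"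
  obtains c where "x' = c * x" "y' = c * y"
proof (cases "y = 0")
  case True
  then have "x \<noteq> 0" "y' = 0" using assms by (auto simp: hom_point_def split: if_splits)
  then show ?thesis using that[of "x' / x"] True by simp
next
  case False
  then have "x * y' = x' * y" using hom_point_eq_iff[OF assms(2,3)] assms(1) by simp
  then show ?thesis using that[of "y' / y"] False by (simp add: field_simps)
qed

text \<open>The coefficients of the left factor solve a homogeneous linear system with one equation
  for each of \<open>2 * m + 1\<close> general fibres of \<open>F\<close>. The polynomial \<open>S\<close> that expresses
  \<open>f = a \<circ> F\<close> vanishes on a whole fibre as soon as it vanishes at one of its points, because \<open>f\<close>
  is constant there; so it has more zeros than its degree allows.\<close>

lemma (in nonconstant_rational) ex_left_factor:
  assumes f: "rational_of_degree f m"
    and const: "\<forall>\<^sub>\<infinity>w. \<forall>w'. F w' = F w \<longrightarrow> f w' = f w"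
  shows "\<exists>a k. rational_of_degree a k \<and> f = a \<circ> F"
proof -
  obtain u v where uv: "coprime u v" "F = quot_map u v" "n = max (degree u) (degree v)"
    using rational unfolding rational_of_degree_def by blast
  obtain p q where pq: "coprime p q" "f = quot_map p q" "m = max (degree p) (degree q)"
    using f unfolding rational_of_degree_def by blast
  define good where "good = (\<lambda>t. card (F -` {t}) = n \<and> t \<noteq> F None \<and> (\<forall>w. F w = t \<longrightarrow> (\<forall>w'. F w' = F w \<longrightarrow> f w' = f w)))"
  have "\<forall>\<^sub>\<infinity>t. good t"
    unfolding good_def
    by (intro MOST_conjI MOST_card_fibre MOST_neq MOST_fibre[OF const])
  then have "infinite {t. good t}"
    using MOST_INFM[OF infinite_UNIV_cp1] INFM_iff_infinite by blast
  \<comment> \<open>There are \<open>2 * m + 2\<close> unknown coefficients, so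
    \<open>2 * m + 1\<close> equations leave a nontrivial solution.\<close>
  then obtain T where T: "finite T" "card T = 2 * m + 1" "T \<subseteq> {t. good t}"
    using infinite_arbitrarily_large by blast
  have "\<exists>z. F (Some z) = t" if "t \<in> T" for t
  proof -
    obtain w where "F w = t" using surj by (metis surjD)
    moreover have "good t" using that T by auto
    ultimately show ?thesis by (cases w) (auto simp: good_def)
  qed
  then obtain r where r: "\<And>t. t \<in> T \<Longrightarrow> F (Some (r t)) = t" by metis
  \<comment> \<open>The index \<open>True\<close> marks coefficients of the numerator
    \<open>\<alpha>\<close>, \<open>False\<close> those of the denominator
    \<open>\<beta>\<close>.\<close>
  define I where "I = (UNIV :: bool set) \<times> {..m}"
  define c where "c = (\<lambda>t (b, i). (if b then poly q (r t) else - poly p (r t)) *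
    poly u (r t) ^ i * poly v (r t) ^ (m - i))"
  have "card T < card I" using T by (simp add: I_def card_cartesian_product)
  then obtain x where x: "\<exists>i\<in>I. x i \<noteq> 0" "\<forall>t\<in>T. (\<Sum>i\<in>I. c t i * x i) = 0"
    using ex_nonzero_solution[of T I c] T(1) by (auto simp: I_def)
  define \<alpha> \<beta> where "\<alpha> = (\<Sum>i\<le>m. monom (x (True, i)) i)" and "\<beta> = (\<Sum>i\<le>m. monom (x (False, i)) i)"
  have coeff: "coeff \<alpha> i = x (True, i)" "coeff \<beta> i = x (False, i)" if "i \<le> m" for i
    using that by (simp_all add: \<alpha>_def \<beta>_def coeff_sum)
  have deg: "degree \<alpha> \<le> m" "degree \<beta> \<le> m"
    unfolding \<alpha>_def \<beta>_def by (intro degree_sum_le; auto intro: order.trans[OF degree_monom_le])+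
  define S where "S = hom_comp \<alpha> m u v * q - hom_comp \<beta> m u v * p"
  have S_eval: "poly S z = hom_eval \<alpha> m (poly u z) (poly v z) * poly q z -
      hom_eval \<beta> m (poly u z) (poly v z) * poly p z" for z
    by (simp add: S_def poly_hom_comp)
  have S_r: "poly S (r t) = 0" if "t \<in> T" for t
  proof -
    have "(\<Sum>i\<in>I. c t i * x i) = (\<Sum>b\<in>UNIV. \<Sum>i\<le>m. c t (b, i) * x (b, i))"
      by (simp add: I_def sum.cartesian_product)
    also have "\<dots> = poly S (r t)"
      unfolding S_eval hom_eval_def UNIV_bool
      by (simp add: c_def coeff sum_distrib_left sum_subtractf sum_negf algebra_simps)
    finally show ?thesis using x(2) that by simp
  qed
  have S_fibre: "poly S z = 0" if "t \<in> T" "F (Some z) = t" for t z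
  proof -
    have "hom_point (poly u (r t)) (poly v (r t)) = hom_point (poly u z) (poly v z)"
      using r that by (simp add: uv quot_map_Some)
    from hom_point_eq_imp_scale[OF this coprime_poly_nonzero[OF uv(1)] coprime_poly_nonzero[OF uv(1)]]
    obtain a where a: "poly u z = a * poly u (r t)" "poly v z = a * poly v (r t)" by blast
    have "f (Some (r t)) = f (Some z)"
      using T(3) that r[OF that(1)] unfolding good_def by blast
    then have "hom_point (poly p (r t)) (poly q (r t)) = hom_point (poly p z) (poly q z)"
      by (simp add: pq quot_map_Some)
    from hom_point_eq_imp_scale[OF this coprime_poly_nonzero[OF pq(1)] coprime_poly_nonzero[OF pq(1)]]
    obtain b where b: "poly p z = b * poly p (r t)" "poly q z = b * poly q (r t)" by blast
    have "poly S z = a ^ m * b * poly S (r t)"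
      unfolding S_eval a b hom_eval_scale by (simp add: algebra_simps)
    then show ?thesis using S_r[OF that(1)] by simp
  qed
  have "S = 0"
  proof (rule ccontr)
    assume "S \<noteq> 0"
    have sub: "(\<Union>t\<in>T. F -` {t}) \<subseteq> Some ` {z. poly S z = 0}"
    proof
      fix w assume "w \<in> (\<Union>t\<in>T. F -` {t})"
      then obtain t where t: "t \<in> T" "F w = t" by auto
      then have "F w \<noteq> F None" using T(3) by (auto simp: good_def)
      then have "w \<noteq> None" by (intro notI) simp
      then show "w \<in> Some ` {z. poly S z = 0}" using S_fibre[OF t(1)] t(2) by auto
    qed
    \<comment> \<open>The chosen fibres provide \<open>(2 * m + 1) * n\<close> zeros, while the
      degree is at most \<open>n * m + m\<close>.\<close>
    have "card (\<Union>t\<in>T. F -` {t}) = (\<Sum>t\<in>T. card (F -` {t}))"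
      by (intro card_UN_disjoint T ballI finite_fibre) auto
    also have "\<dots> = (\<Sum>t\<in>T. n)" using T(3) by (intro sum.cong) (auto simp: good_def)
    also have "\<dots> = (2 * m + 1) * n" using T by simp
    finally have "(2 * m + 1) * n \<le> card (Some ` {z. poly S z = 0})"
      using card_mono[OF _ sub] poly_roots_finite[OF \<open>S \<noteq> 0\<close>] by simp
    also have "\<dots> = card {z. poly S z = 0}" by (simp add: card_image)
    also have "\<dots> \<le> degree S" using \<open>S \<noteq> 0\<close> by (rule card_poly_roots_bound)
    also have "\<dots> \<le> n * m + m"
      unfolding S_def using uv(3) pq(3)
      by (intro degree_diff_le order.trans[OF degree_mult_le] add_mono degree_hom_comp_le) auto
    finally have "n * m + n \<le> m" by (simp add: algebra_simps)
    moreover have "m \<le> n * m" using pos by simp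
    ultimately show False using pos by linarith
  qed
  obtain b i where "x (b, i) \<noteq> 0" "i \<le> m" using x(1) by (auto simp: I_def)
  then have "coeff \<alpha> i \<noteq> 0 \<or> coeff \<beta> i \<noteq> 0" by (cases b) (simp_all add: coeff)
  \<comment> \<open>The solution need not be reduced; cancelling the common divisor changes no value
    away from its zeros.\<close>
  then have g0: "gcd \<alpha> \<beta> \<noteq> 0" by auto
  then obtain \<alpha>' \<beta>' where ab: "\<alpha> = \<alpha>' * gcd \<alpha> \<beta>" "\<beta> = \<beta>' * gcd \<alpha> \<beta>" "coprime \<alpha>' \<beta>'"
    using gcd_coprime_exists by blast
  define a where "a = quot_map \<alpha>' \<beta>'"
  have a: "rational_of_degree a (max (degree \<alpha>') (degree \<beta>'))"
    using ab(3) unfolding rational_of_degree_def a_def by blast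
  have "\<forall>\<^sub>\<infinity>t. t \<noteq> F None \<and> (\<exists>s. t = Some s \<and> poly (gcd \<alpha> \<beta>) s \<noteq> 0)"
    using MOST_poly_nonzero[OF g0] by (intro MOST_conjI MOST_neq) (simp add: MOST_option_iff)
  from MOST_vimage[OF this] have "\<forall>\<^sub>\<infinity>w. f w = (a \<circ> F) w"
  proof (rule MOST_mono)
    fix w assume w: "F w \<noteq> F None \<and> (\<exists>s. F w = Some s \<and> poly (gcd \<alpha> \<beta>) s \<noteq> 0)"
    then obtain z s where z: "w = Some z" and s: "F w = Some s" and gs: "poly (gcd \<alpha> \<beta>) s \<noteq> 0"
      by (cases w) auto
    have vz: "poly v z \<noteq> 0" "s = poly u z / poly v z"
      using s by (auto simp: z uv quot_map_Some hom_point_def split: if_splits)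
    have "poly S z = 0" using \<open>S = 0\<close> by simp
    then have "poly v z ^ m * (poly \<alpha> s * poly q z) = poly v z ^ m * (poly \<beta> s * poly p z)"
      unfolding S_eval using hom_eval_eq_poly[OF deg(1) vz(1), of "poly u z"]
        hom_eval_eq_poly[OF deg(2) vz(1), of "poly u z"] vz(2) by (simp add: mult.assoc)
    then have "poly \<alpha> s * poly q z = poly \<beta> s * poly p z" using vz(1) by simp
    moreover have "poly \<alpha> s = poly \<alpha>' s * poly (gcd \<alpha> \<beta>) s" "poly \<beta> s = poly \<beta>' s * poly (gcd \<alpha> \<beta>) s"
      using ab(1,2) by (metis poly_mult)+
    ultimately have "poly \<alpha>' s * poly q z = poly p z * poly \<beta>' s" using gs by (simp add: mult_ac)
    then have "hom_point (poly \<alpha>' s) (poly \<beta>' s) = hom_point (poly p z) (poly q z)"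
      using hom_point_eq_iff[OF coprime_poly_nonzero[OF ab(3)] coprime_poly_nonzero[OF pq(1)]] by blast
    then show "f w = (a \<circ> F) w" using s by (simp add: z a_def pq quot_map_Some)
  qed
  then have "\<exists>\<^sub>\<infinity>w. f w = (a \<circ> F) w" by (rule MOST_INFM[OF infinite_UNIV_cp1])
  then have "f = a \<circ> F" by (rule rational_eqI[OF f rational_comp[OF a rational]])
  then show ?thesis using a by blast
qed

subsection \<open>Lueroth's theorem\<close>

text \<open>Bezout's identity with denominators cleared by \<open>r\<close>. A combination of least
  degree divides every combination up to a factor from the coefficient ring; by Gauss's lemma its
  primitive part divides without that factor.\<close>

lemma ex_gcd_combination:
  fixes f h :: "complex poly poly"
  assumes "f \<noteq> 0"
  shows "\<exists>G r s t. G dvd f \<and> G dvd h \<and> r \<noteq> 0 \<and> smult r G = s * f + t * h"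
proof -
  define J where "J = (\<lambda>g. g \<noteq> 0 \<and> (\<exists>s t. g = s * f + t * h))"
  have "f = 1 * f + 0 * h" by simp
  then have "J f" using assms unfolding J_def by blast
  then obtain g where g: "J g" "\<And>g'. J g' \<Longrightarrow> degree g \<le> degree g'"
    using ex_has_least_nat[of J f degree] by blast
  then obtain s t where st: "g = s * f + t * h" and g0: "g \<noteq> 0" unfolding J_def by blast
  have dvd: "primitive_part g dvd x" if x: "x = s' * f + t' * h" for x s' t'
  proof -
    obtain a k where ak: "a \<noteq> 0" "smult a x = g * k + pseudo_mod x g"
      and small: "pseudo_mod x g = 0 \<or> degree (pseudo_mod x g) < degree g"
      using pseudo_mod[OF g0] by blast
    \<comment> \<open>The pseudo-remainder is again a combination, and of smaller degree than the
      minimal \<open>g\<close> unless it vanishes.\<close>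
    have "pseudo_mod x g = smult a x - g * k" using ak(2) by simp
    also have "\<dots> = (smult a s' - s * k) * f + (smult a t' - t * k) * h"
      unfolding x st by (simp add: algebra_simps smult_add_right)
    finally have "pseudo_mod x g = 0" using g(2)[of "pseudo_mod x g"] small unfolding J_def by (meson not_le)
    then have "g dvd smult a x" using ak by simp
    then have 1: "primitive_part g dvd smult (unit_factor a) (primitive_part x)"
      by (metis primitive_part_dvd_primitive_partI primitive_part_smult)
    have "is_unit (unit_factor a)" using ak(1) by simp
    then obtain b where "unit_factor a * b = 1" by (metis dvdE)
    then have "primitive_part x = smult b (smult (unit_factor a) (primitive_part x))"
      by (simp add: mult.commute)
    then have "primitive_part g dvd primitive_part x" using 1 by (metis dvd_smult)
    then show ?thesis by (metis content_times_primitive_part dvd_smult)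
  qed
  have "primitive_part g dvd f" by (rule dvd[of _ 1 0]) simp
  moreover have "primitive_part g dvd h" by (rule dvd[of _ 0 1]) simp
  moreover have "smult (content g) (primitive_part g) = s * f + t * h" using st by simp
  moreover have "content g \<noteq> 0" using g0 by simp
  ultimately show ?thesis by blast
qed

text \<open>The polynomial cuts out the fibre through \<open>z\<close>. At a multiple root
  \<open>y\<close> the values and the derivatives of \<open>p\<close> and \<open>q\<close> would
  both be proportional to their values at \<open>z\<close>, so the Wronskian would vanish at
  \<open>y\<close>.\<close>

lemma (in nonconstant_rational) MOST_rsquarefree:
  assumes "coprime p q" "F = quot_map p q" "n = max (degree p) (degree q)"
  shows "\<forall>\<^sub>\<infinity>z. rsquarefree (smult (poly q z) p - smult (poly p z) q)"
proof -
  have "\<forall>\<^sub>\<infinity>w. \<forall>y. w = Some y \<longrightarrow> poly (pderiv p * q - p * pderiv q) y \<noteq> 0"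
    unfolding MOST_option_iff
    using MOST_poly_nonzero[OF wronskian_nonzero[OF assms(1)]] pos assms(3) by simp
  from MOST_same_fibre[OF this]
  have "\<forall>\<^sub>\<infinity>z. \<forall>y. F (Some y) = F (Some z) \<longrightarrow> poly (pderiv p * q - p * pderiv q) y \<noteq> 0"
    unfolding MOST_option_iff by (rule MOST_mono) blast
  then show ?thesis
  proof (rule MOST_mono)
    fix z assume z: "\<forall>y. F (Some y) = F (Some z) \<longrightarrow> poly (pderiv p * q - p * pderiv q) y \<noteq> 0"
    show "rsquarefree (smult (poly q z) p - smult (poly p z) q)"
      unfolding rsquarefree_roots
    proof (intro allI notI)
      fix y
      assume "poly (smult (poly q z) p - smult (poly p z) q) y = 0 \<and>
        poly (pderiv (smult (poly q z) p - smult (poly p z) q)) y = 0"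
      then have eq: "poly q z * poly p y = poly p z * poly q y"
        "poly q z * poly (pderiv p) y = poly p z * poly (pderiv q) y"
        by (simp_all add: pderiv_diff pderiv_smult)
      then have "F (Some y) = F (Some z)"
        unfolding assms(2) quot_map_Some
        by (subst hom_point_eq_iff[OF coprime_poly_nonzero[OF assms(1)] coprime_poly_nonzero[OF assms(1)]])
          (simp add: mult.commute)
      then have nz: "poly (pderiv p) y * poly q y - poly p y * poly (pderiv q) y \<noteq> 0" using z by simp
      have "poly q z * (poly (pderiv p) y * poly q y - poly p y * poly (pderiv q) y) = 0"
        using eq by algebra
      moreover have "poly p z * (poly (pderiv p) y * poly q y - poly p y * poly (pderiv q) y) = 0"
        using eq by algebra
      ultimately show False using nz coprime_poly_nonzero[OF assms(1), of z] by simp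
    qed
  qed
qed

text \<open>In \<open>P :: complex poly poly\<close> the outer variable is called \<open>y\<close> and the inner one \<open>z\<close>.\<close>

definition lift_poly :: "complex poly \<Rightarrow> complex poly poly" where
  "lift_poly p = map_poly (\<lambda>c. [:c:]) p"

text \<open>Specialises \<open>z\<close> and keeps a polynomial in \<open>y\<close>, whereas
  \<open>poly P [:y:]\<close> specialises \<open>y\<close> and keeps one in
  \<open>z\<close>.\<close>

definition eval_inner :: "complex \<Rightarrow> complex poly poly \<Rightarrow> complex poly" where
  "eval_inner z P = map_poly (\<lambda>g. poly g z) P"

lemma poly_lift_poly: "poly (lift_poly p) [:y:] = [:poly p y:]"
  by (induction p) (simp_all add: lift_poly_def map_poly_pCons)

lemma poly_eval_inner: "poly (eval_inner z P) y = poly (poly P [:y:]) z"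
  by (induction P) (simp_all add: eval_inner_def map_poly_pCons)

lemma eval_inner_dvd:
  assumes "P dvd Q"
  shows "eval_inner z P dvd eval_inner z Q"
proof -
  obtain K where "Q = P * K" using assms by (elim dvdE)
  then have "poly (eval_inner z Q) y = poly (eval_inner z P * eval_inner z K) y" for y
    by (simp add: poly_eval_inner)
  then have "eval_inner z Q = eval_inner z P * eval_inner z K" by (intro poly_ext) auto
  then show ?thesis by simp
qed

text \<open>The leading coefficient is a nonzero polynomial in \<open>z\<close>, so the degree can
  drop only at its zeros.\<close>

lemma MOST_degree_eval_inner:
  assumes "P \<noteq> 0"
  shows "\<forall>\<^sub>\<infinity>z. degree (eval_inner z P) = degree P"
proof -
  have "\<forall>\<^sub>\<infinity>z. poly (lead_coeff P) z \<noteq> 0" using assms by (intro MOST_poly_nonzero) simp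
  then show ?thesis
  proof (rule MOST_mono)
    fix z assume "poly (lead_coeff P) z \<noteq> 0"
    then have "coeff (eval_inner z P) (degree P) \<noteq> 0" by (simp add: eval_inner_def coeff_map_poly)
    moreover have "degree (eval_inner z P) \<le> degree P" unfolding eval_inner_def by (rule degree_le) (simp add: coeff_map_poly coeff_eq_0)
    ultimately show "degree (eval_inner z P) = degree P" using le_degree by (metis le_antisym)
  qed
qed

text \<open>The numerator \<open>p y * q z - q y * p z\<close> of the difference
  \<open>F y - F z\<close> for \<open>F = p / q\<close>.\<close>

definition cross_poly :: "complex poly \<Rightarrow> complex poly \<Rightarrow> complex poly poly" where
  "cross_poly p q = smult q (lift_poly p) - smult p (lift_poly q)"

lemma poly_cross_poly:
  "poly (cross_poly p q) [:y:] = smult (poly p y) q - smult (poly q y) p"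
  by (simp add: cross_poly_def poly_lift_poly)

lemma cross_poly_eq_0_iff:
  assumes "coprime p q"
  shows "poly (poly (cross_poly p q) [:y:]) z = 0 \<longleftrightarrow> quot_map p q (Some y) = quot_map p q (Some z)"
  unfolding quot_map_Some
  by (subst hom_point_eq_iff[OF coprime_poly_nonzero[OF assms] coprime_poly_nonzero[OF assms]])
    (simp add: poly_cross_poly mult.commute)

lemma eval_inner_cross_poly:
  "eval_inner z (cross_poly p q) = smult (poly q z) p - smult (poly p z) q"
  by (rule poly_ext) (simp add: poly_eval_inner poly_cross_poly mult.commute)

text \<open>The greatest common divisor \<open>G\<close> of the polynomials expressing \<open>F y = F z\<close> and \<open>H y = H z\<close>
  describes, for general \<open>z\<close>, the class of points that neither map separates from \<open>z\<close>. The roots of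
  \<open>G(y, z)\<close> in \<open>y\<close> determine it up to a factor, so \<open>W z = G(y0, z) / G(y1, z)\<close> is constant on
  classes, while its zeros are the class of \<open>y0\<close>: its fibres are exactly the classes.\<close>

theorem lueroth:
  assumes "rational_of_degree F n" "n \<ge> 1" "rational_of_degree H m"
    and "\<exists>\<^sub>\<infinity>w. \<exists>w'. w' \<noteq> w \<and> F w' = F w \<and> H w' = H w"
  shows "\<exists>W d. rational_of_degree W d \<and> d \<ge> 2 \<and>
    (\<exists>a k. rational_of_degree a k \<and> F = a \<circ> W) \<and> (\<exists>b l. rational_of_degree b l \<and> H = b \<circ> W)"
proof -
  interpret F: nonconstant_rational F n using assms by unfold_locales
  obtain p q where pq: "coprime p q" "F = quot_map p q" "n = max (degree p) (degree q)"
    using assms(1) unfolding rational_of_degree_def by blast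
  obtain u v where uv: "coprime u v" "H = quot_map u v"
    using assms(3) unfolding rational_of_degree_def by blast
  \<comment> \<open>Only finite points enter a class; for general points, \<open>fibre_good\<close>
    keeps infinity out of the fibre.\<close>
  define cl where "cl = (\<lambda>z. {y. F (Some y) = F (Some z) \<and> H (Some y) = H (Some z)})"
  have cl_iff: "y \<in> cl z \<longleftrightarrow> poly (poly (cross_poly p q) [:y:]) z = 0 \<and> poly (poly (cross_poly u v) [:y:]) z = 0" for y z
    using cross_poly_eq_0_iff[OF pq(1)] cross_poly_eq_0_iff[OF uv(1)] by (simp add: cl_def pq(2) uv(2))
  have cl_eq: "cl y = cl z" if "y \<in> cl z" for y z
    using that by (auto simp: cl_def)
  have cl_self: "z \<in> cl z" for z by (simp add: cl_def)
  have cl_finite: "finite (cl z)" for z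
  proof -
    have "Some ` cl z \<subseteq> F -` {F (Some z)}" by (auto simp: cl_def)
    then show ?thesis using F.finite_fibre by (meson finite_imageD finite_subset inj_Some)
  qed
  have sqf: "\<forall>\<^sub>\<infinity>z. rsquarefree (smult (poly q z) p - smult (poly p z) q)"
    by (rule F.MOST_rsquarefree[OF pq])
  have "cross_poly p q \<noteq> 0"
  proof
    assume 0: "cross_poly p q = 0"
    obtain z where "rsquarefree (smult (poly q z) p - smult (poly p z) q)"
      using MOST_complex_ex[OF sqf] by blast
    moreover have "smult (poly q z) p - smult (poly p z) q = 0"
      unfolding eval_inner_cross_poly[symmetric] 0 by (simp add: eval_inner_def)
    ultimately show False by (simp add: rsquarefree_def)
  qed
  then obtain G r s t where G: "G dvd cross_poly p q" "G dvd cross_poly u v" "r \<noteq> 0"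
      "smult r G = s * cross_poly p q + t * cross_poly u v"
    using ex_gcd_combination by blast
  have "G \<noteq> 0" using G(1) \<open>cross_poly p q \<noteq> 0\<close> by auto
  have root_imp: "y \<in> cl z" if "poly (poly G [:y:]) z = 0" for y z
  proof -
    obtain K L where "cross_poly p q = G * K" "cross_poly u v = G * L" using G(1,2) by (metis dvdE)
    then show ?thesis using that by (simp add: cl_iff)
  qed
  \<comment> \<open>Passing from the class to a root uses the combination, where \<open>r\<close>
    must not vanish; the other direction holds for all \<open>z\<close>.\<close>
  have root_iff: "poly (poly G [:y:]) z = 0 \<longleftrightarrow> y \<in> cl z" if "poly r z \<noteq> 0" for y z
  proof
    assume "y \<in> cl z"
    have "poly (poly (smult r G) [:y:]) z = 0"
      unfolding G(4) using \<open>y \<in> cl z\<close> by (simp add: cl_iff)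
    then show "poly (poly G [:y:]) z = 0" using that by simp
  qed (rule root_imp)
  define d where "d = degree G"
  define good where "good = (\<lambda>z. poly r z \<noteq> 0 \<and> degree (eval_inner z G) = d \<and>
    rsquarefree (smult (poly q z) p - smult (poly p z) q))"
  have good: "\<forall>\<^sub>\<infinity>z. good z"
    unfolding good_def d_def
    by (intro MOST_conjI MOST_poly_nonzero G(3) MOST_degree_eval_inner \<open>G \<noteq> 0\<close> sqf)
  have roots: "{y. poly (eval_inner z G) y = 0} = cl z" if "good z" for z
    using root_iff that by (auto simp: good_def poly_eval_inner)
  have card_cl: "card (cl z) = d" if "good z" for z
  proof -
    have "eval_inner z G dvd smult (poly q z) p - smult (poly p z) q"
      using eval_inner_dvd[OF G(1)] by (simp add: eval_inner_cross_poly)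
    then have "rsquarefree (eval_inner z G)" using that rsquarefree_dvd by (auto simp: good_def)
    then have "card (cl z) = degree (eval_inner z G)"
      using rsquarefree_card_roots roots[OF that] by metis
    then show ?thesis using that by (simp add: good_def)
  qed
  \<comment> \<open>For two good points of one class the specialisations have degree
    \<open>d\<close> and the same \<open>d\<close> roots, so they differ by a constant
    factor.\<close>
  have proportional: "\<exists>c. c \<noteq> 0 \<and> (\<forall>y. poly (poly G [:y:]) z' = c * poly (poly G [:y:]) z)"
    if "good z" "good z'" "z' \<in> cl z" for z z'
  proof -
    define P Q where "P = eval_inner z G" and "Q = eval_inner z' G"
    have "degree P = d" "degree Q = d" using that by (auto simp: P_def Q_def good_def)
    have nz: "lead_coeff P \<noteq> 0" "lead_coeff Q \<noteq> 0"
    proof -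
      show "lead_coeff P \<noteq> 0"
        using roots[OF that(1)] cl_finite[of z] infinite_UNIV_char_0[where 'a = complex] by (auto simp: P_def)
      show "lead_coeff Q \<noteq> 0"
        using roots[OF that(2)] cl_finite[of z'] infinite_UNIV_char_0[where 'a = complex] by (auto simp: Q_def)
    qed
    have "smult (lead_coeff Q) P = smult (lead_coeff P) Q"
    proof (rule poly_eqI_degree_lead_coeff[where n = d and A = "cl z"])
      show "card (cl z) \<ge> d" using card_cl[OF that(1)] by simp
      fix y assume "y \<in> cl z"
      then have "poly P y = 0" "poly Q y = 0"
        using roots[OF that(1)] roots[OF that(2)] cl_eq[OF that(3)] by (auto simp: P_def Q_def)
      then show "poly (smult (lead_coeff Q) P) y = poly (smult (lead_coeff P) Q) y" by simp
    qed (use \<open>degree P = d\<close> \<open>degree Q = d\<close> in \<open>simp_all add: mult.commute\<close>)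
    then have "lead_coeff Q * poly P y = lead_coeff P * poly Q y" for y
      by (metis poly_smult)
    then have "poly Q y = lead_coeff Q / lead_coeff P * poly P y" for y
      using nz by (simp add: field_simps)
    then show ?thesis using nz by (intro exI[of _ "lead_coeff Q / lead_coeff P"]) (auto simp: P_def Q_def poly_eval_inner)
  qed
  have fibre_good: "\<forall>\<^sub>\<infinity>w. \<forall>w'. F w' = F w \<longrightarrow> (\<exists>y. w' = Some y \<and> good y)"
    by (rule F.MOST_same_fibre) (use good in \<open>simp add: MOST_option_iff\<close>)
  have "d \<ge> 2"
  proof -
    obtain w w' where w: "w' \<noteq> w" "F w' = F w" "H w' = H w"
      and g: "\<forall>w'. F w' = F w \<longrightarrow> (\<exists>y. w' = Some y \<and> good y)"
      using INFM_EX[OF INFM_conjI[OF assms(4) fibre_good]] by blast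
    obtain z z' where z: "w = Some z" "good z" "w' = Some z'" using g w by metis
    then have "{z, z'} \<subseteq> cl z" using w by (auto simp: cl_def)
    then have "card {z, z'} \<le> d" using card_mono[OF cl_finite] card_cl[OF z(2)] by metis
    then show ?thesis using w z by auto
  qed
  \<comment> \<open>Two distinct classes are chosen so that \<open>W0\<close> and \<open>W1\<close>
    become coprime: at a common root \<open>z\<close>, both \<open>y0\<close> and \<open>y1\<close>
    would lie in the class of \<open>z\<close>.\<close>
  obtain y0 where y0: "good y0" using MOST_complex_ex[OF good] by blast
  have "\<forall>\<^sub>\<infinity>y. y \<notin> cl y0" using cl_finite by (simp add: eventually_cofinite)
  then obtain y1 where y1: "good y1" "y1 \<notin> cl y0"
    using MOST_complex_ex[OF MOST_conjI[OF good]] by blast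
  \<comment> \<open>The degree in the other variable is bounded too: this polynomial in
    \<open>z\<close> is square-free, with all its roots in the \<open>d\<close>-element class of
    \<open>y\<close>.\<close>
  have deg: "degree (poly G [:y:]) \<le> d \<and> poly G [:y:] \<noteq> 0" if "good y" for y
  proof -
    obtain K where "cross_poly p q = G * K" using G(1) by (elim dvdE)
    then have "poly (cross_poly p q) [:y:] = poly G [:y:] * poly K [:y:]" by simp
    then have "poly G [:y:] dvd - (smult (poly q y) p - smult (poly p y) q)"
      unfolding poly_cross_poly by simp
    then have "poly G [:y:] dvd smult (poly q y) p - smult (poly p y) q" by (simp only: dvd_minus_iff)
    then have "rsquarefree (poly G [:y:])" using that rsquarefree_dvd by (auto simp: good_def)
    moreover have "{z. poly (poly G [:y:]) z = 0} \<subseteq> cl y"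
      using root_imp cl_eq cl_self by blast
    ultimately show ?thesis
      using rsquarefree_card_roots card_mono[OF cl_finite] card_cl[OF that]
      by (metis rsquarefree_def)
  qed
  define W0 W1 where "W0 = poly G [:y0:]" and "W1 = poly G [:y1:]"
  have cop: "coprime W0 W1"
    unfolding coprime_iff_no_common_root W0_def W1_def
    using root_imp cl_eq cl_self y1(2) by blast
  define W where "W = quot_map W0 W1"
  define e where "e = max (degree W0) (degree W1)"
  \<comment> \<open>Having a root without being zero, \<open>W0\<close> is nonconstant, hence
    \<open>e \<ge> 1\<close>.\<close>
  have "poly W0 y0 = 0" using root_iff[of y0 y0] y0 cl_self by (simp add: good_def W0_def)
  then have "degree W0 \<noteq> 0" using deg[OF y0] unfolding W0_def
    by (metis degree_eq_zeroE pCons_eq_0_iff poly_const_conv)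
  then have e: "e \<ge> 1" "e \<le> d" using deg[OF y0] deg[OF y1(1)] by (auto simp: e_def W0_def W1_def)
  have W: "rational_of_degree W e" using cop unfolding rational_of_degree_def W_def e_def by blast
  interpret W: nonconstant_rational W e using W e by unfold_locales
  \<comment> \<open>A general fibre of \<open>W\<close> has \<open>e \<le> d\<close> points and
    contains a class of \<open>d\<close> points, so the two coincide.\<close>
  have fibres: "\<forall>\<^sub>\<infinity>w. e = d \<and> (\<forall>w'. W w' = W w \<longrightarrow> F w' = F w \<and> H w' = H w)"
    using MOST_conjI[OF fibre_good W.MOST_vimage[OF W.MOST_card_fibre]]
  proof (rule MOST_mono)
    fix w assume w: "(\<forall>w'. F w' = F w \<longrightarrow> (\<exists>y. w' = Some y \<and> good y)) \<and> card (W -` {W w}) = e"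
    then obtain z where z: "w = Some z" "good z" by blast
    have sub: "Some ` cl z \<subseteq> W -` {W w}"
    proof
      fix w' assume "w' \<in> Some ` cl z"
      then obtain y where y: "w' = Some y" "y \<in> cl z" by auto
      then have "good y" using w z by (auto simp: cl_def)
      then obtain c where "c \<noteq> 0" "\<forall>x. poly (poly G [:x:]) y = c * poly (poly G [:x:]) z"
        using proportional[OF z(2) _ y(2)] by blast
      then show "w' \<in> W -` {W w}"
        by (simp add: y(1) z(1) W_def quot_map_Some W0_def W1_def hom_point_scale)
    qed
    have "d \<le> e" using card_mono[OF W.finite_fibre sub] w card_cl[OF z(2)] by (simp add: card_image)
    then have "e = d" using e by simp
    then have "Some ` cl z = W -` {W w}"
      using w card_cl[OF z(2)] by (intro card_subset_eq[OF W.finite_fibre sub]) (simp add: card_image)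
    then have "\<forall>w'. W w' = W w \<longrightarrow> w' \<in> Some ` cl z" by blast
    then show "e = d \<and> (\<forall>w'. W w' = W w \<longrightarrow> F w' = F w \<and> H w' = H w)"
      using \<open>e = d\<close> z(1) by (auto simp: cl_def)
  qed
  have "e = d" using MOST_cp1_ex[OF fibres] by blast
  moreover have F: "\<forall>\<^sub>\<infinity>w. \<forall>w'. W w' = W w \<longrightarrow> F w' = F w"
    using fibres by (rule MOST_mono) blast
  moreover have H: "\<forall>\<^sub>\<infinity>w. \<forall>w'. W w' = W w \<longrightarrow> H w' = H w"
    using fibres by (rule MOST_mono) blast
  ultimately show ?thesis
    using W \<open>d \<ge> 2\<close> W.ex_left_factor[OF assms(1) F] W.ex_left_factor[OF assms(3) H] by blast
qed

subsection \<open>Moebius transformations\<close>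

text \<open>For two polynomials of maximal degree one, a vanishing determinant is the same as a
  common root.\<close>

lemma moebius_iff_rational: "moebius \<sigma> \<longleftrightarrow> rational_of_degree \<sigma> 1"
proof
  assume "moebius \<sigma>"
  then obtain a b c d where det: "a * d - b * c \<noteq> 0" and \<sigma>: "\<sigma> = quot_map [:b, a:] [:d, c:]"
    unfolding moebius_def by blast
  have "coprime [:b, a:] [:d, c:]"
    unfolding coprime_iff_no_common_root
  proof (intro allI notI)
    fix z assume "poly [:b, a:] z = 0 \<and> poly [:d, c:] z = 0"
    then have "b = - (z * a)" "d = - (z * c)" by (simp_all add: add_eq_0_iff2)
    with det show False by simp
  qed
  moreover have "max (degree [:b, a:]) (degree [:d, c:]) = 1" using det by auto
  ultimately show "rational_of_degree \<sigma> 1" using \<sigma> unfolding rational_of_degree_def by metis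
next
  assume "rational_of_degree \<sigma> 1"
  then obtain p q where pq: "coprime p q" "\<sigma> = quot_map p q" "max (degree p) (degree q) = 1"
    unfolding rational_of_degree_def by metis
  have linear: "f = [:coeff f 0, coeff f 1:]" if "degree f \<le> 1" for f :: "complex poly"
  proof (rule poly_eqI)
    fix i show "coeff f i = coeff [:coeff f 0, coeff f 1:] i"
      using that by (cases i; cases "i - 1") (auto simp: coeff_eq_0)
  qed
  obtain a b c d where p: "p = [:b, a:]" and q: "q = [:d, c:]"
    using linear[of p] linear[of q] pq(3) by (metis max.cobounded1 max.cobounded2)
  have "a * d - b * c \<noteq> 0"
  proof
    assume det: "a * d - b * c = 0"
    show False
    proof (cases "c = 0")
      case True
      then have "a \<noteq> 0" using pq(3) p q by (auto split: if_splits)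
      then have "d = 0" using det True by simp
      then show False using coprime_poly_nonzero[OF pq(1), of "- b / a"] \<open>a \<noteq> 0\<close> True by (simp add: p q)
    next
      case False
      then show False
        using coprime_poly_nonzero[OF pq(1), of "- d / c"] det by (simp add: p q field_simps)
    qed
  qed
  then show "moebius \<sigma>" using pq(2) p q unfolding moebius_def by metis
qed

lemma moebius_hom_point:
  assumes "a * d - b * c \<noteq> 0" "(x, y) \<noteq> (0, 0)"
  shows "quot_map [:b, a:] [:d, c:] (hom_point x y) = hom_point (a * x + b * y) (c * x + d * y)"
proof -
  have "max (degree [:b, a:]) (degree [:d, c:]) = 1" using assms(1) by auto
  then show ?thesis
    using quot_map_hom_point[of 1 "[:b, a:]" "[:d, c:]" x y] assms(2)
    by (simp add: hom_eval_def add.commute)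
qed

lemma moebius_id: "moebius id"
proof -
  have "quot_map [:0, 1:] [:1, 0:] w = w" for w
    by (rule hom_point_cases[of w]) (use moebius_hom_point[of 1 1 0 0] in auto)
  then have "id = quot_map [:0, 1:] [:1, 0:]" by auto
  then show ?thesis unfolding moebius_def by (intro exI[of _ 1] exI[of _ 0]) auto
qed

lemma moebius_comp: "moebius \<sigma> \<Longrightarrow> moebius \<tau> \<Longrightarrow> moebius (\<sigma> \<circ> \<tau>)"
  using rational_comp[of \<sigma> 1 \<tau> 1] by (simp add: moebius_iff_rational)

lemma moebius_inverse:
  assumes "moebius \<sigma>"
  obtains \<tau> where "moebius \<tau>" "\<sigma> \<circ> \<tau> = id" "\<tau> \<circ> \<sigma> = id"
proof -
  obtain a b c d where det: "a * d - b * c \<noteq> 0" and \<sigma>: "\<sigma> = quot_map [:b, a:] [:d, c:]"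
    using assms unfolding moebius_def by blast
  \<comment> \<open>The adjugate matrix: both composites multiply the homogeneous coordinates by the
    determinant.\<close>
  define \<tau> where "\<tau> = quot_map [:- b, d:] [:a, - c:]"
  have det': "d * a - (- b) * (- c) \<noteq> 0" using det by (simp add: mult.commute)
  have hom: "\<sigma> (hom_point x y) = hom_point (a * x + b * y) (c * x + d * y)"
    "\<tau> (hom_point x y) = hom_point (d * x - b * y) (a * y - c * x)" if "(x, y) \<noteq> (0, 0)" for x y
    using moebius_hom_point[OF det that] moebius_hom_point[OF det' that] by (simp_all add: \<sigma> \<tau>_def)
  have nz: "(a * x + b * y, c * x + d * y) \<noteq> (0, 0)" "(d * x - b * y, a * y - c * x) \<noteq> (0, 0)"
    if "(x, y) \<noteq> (0, 0)" for x y
  proof -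
    have "d * (a * x + b * y) - b * (c * x + d * y) = (a * d - b * c) * x"
      "a * (c * x + d * y) - c * (a * x + b * y) = (a * d - b * c) * y"
      "a * (d * x - b * y) + b * (a * y - c * x) = (a * d - b * c) * x"
      "c * (d * x - b * y) + d * (a * y - c * x) = (a * d - b * c) * y"
      by algebra+
    then show "(a * x + b * y, c * x + d * y) \<noteq> (0, 0)" "(d * x - b * y, a * y - c * x) \<noteq> (0, 0)"
      using det that by auto
  qed
  have "(\<tau> \<circ> \<sigma>) w = w \<and> (\<sigma> \<circ> \<tau>) w = w" for w
  proof (rule hom_point_cases[of w])
    fix x y assume w: "w = hom_point x y" and xy: "(x, y) \<noteq> (0, 0)"
    have "(\<tau> \<circ> \<sigma>) w = hom_point ((a * d - b * c) * x) ((a * d - b * c) * y)"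
      using hom(2)[OF nz(1)[OF xy]] by (simp add: w hom(1)[OF xy]) (simp add: algebra_simps)
    moreover have "(\<sigma> \<circ> \<tau>) w = hom_point ((a * d - b * c) * x) ((a * d - b * c) * y)"
      using hom(1)[OF nz(2)[OF xy]] by (simp add: w hom(2)[OF xy]) (simp add: algebra_simps)
    ultimately show ?thesis using det by (simp add: hom_point_scale w)
  qed
  then have "\<tau> \<circ> \<sigma> = id" "\<sigma> \<circ> \<tau> = id" by auto
  moreover have "moebius \<tau>" unfolding moebius_def \<tau>_def using det' by blast
  ultimately show ?thesis using that by blast
qed

lemma moebius_affine: "a \<noteq> 0 \<Longrightarrow> moebius (quot_map [:b, a:] 1)"
  unfolding moebius_def by (intro exI[of _ a] exI[of _ b] exI[of _ 0] exI[of _ 1]) (simp add: one_pCons)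

lemma affine_Some: "quot_map [:b, a:] 1 (Some z) = Some (a * z + b)"
  by (simp add: quot_map_Some hom_point_def add.commute mult.commute)

lemma affine_None: "a \<noteq> 0 \<Longrightarrow> quot_map [:b, a:] 1 None = None"
  by (simp add: quot_map_None hom_point_def)

lemma rational_funpow:
  assumes "rational_of_degree A n"
  shows "rational_of_degree (A ^^ k) (n ^ k)"
proof (induction k)
  case 0
  then show ?case using moebius_id by (simp add: moebius_iff_rational id_def)
next
  case (Suc k)
  then show ?case using rational_comp[OF assms Suc] by (simp only: funpow.simps power_Suc)
qed

lemma surj_comp_cancel: "surj f \<Longrightarrow> g \<circ> f = h \<circ> f \<Longrightarrow> g = h"
  by (metis comp_apply ext surjD)

subsection \<open>Iterates of an indecomposable map\<close>

text \<open>Degrees multiply under composition, so the left factor cannot have degree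
  \<open>0\<close>, and indecomposability excludes degrees above one.\<close>

lemma indecomposable_left_factor:
  assumes A: "rational_of_degree A n" "n \<ge> 2" "indecomposable A"
    and A_eq: "A = B \<circ> C" and B: "rational_of_degree B k" and C: "rational_of_degree C l" "l \<ge> 2"
  shows "moebius B"
proof -
  have "\<not> k \<ge> 2" using A(3) A_eq B C unfolding indecomposable_def by blast
  moreover have "k * l = n" using rational_comp[OF B C(1)] A(1) A_eq rational_degree_unique by metis
  ultimately have "k = 1" using A(2) by (cases "k = 0") auto
  then show ?thesis using B by (simp add: moebius_iff_rational)
qed

text \<open>Both \<open>h\<close> and \<open>A ^^ m\<close> send a fibre of \<open>A\<close> into another one, \<open>A ^^ m\<close> takes a single value on
  it, and in general \<open>h\<close> avoids this value. So only \<open>n - 1\<close> values remain for \<open>h\<close> on the \<open>n\<close> points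
  of the fibre, and \<open>A\<close> and \<open>h\<close> have a common right factor of degree at least two.\<close>

lemma indecomposable_right_factor:
  assumes A: "rational_of_degree A n" "n \<ge> 2" "indecomposable A"
    and h: "rational_of_degree h l" "A \<circ> A ^^ m = A \<circ> h" "m \<ge> 1"
  shows "\<exists>g k. rational_of_degree g k \<and> h = g \<circ> A"
proof (cases "h = A ^^ m")
  case True
  then have "h = A ^^ (m - 1) \<circ> A" using h(3) by (metis funpow_Suc_right Suc_diff_1 less_eq_Suc_le One_nat_def)
  then show ?thesis using rational_funpow[OF A(1)] by blast
next
  case False
  interpret A: nonconstant_rational A n using A by unfold_locales auto
  have Am: "rational_of_degree (A ^^ m) (n ^ m)" by (rule rational_funpow[OF A(1)])
  have "rational_of_degree (A \<circ> A ^^ m) (n * n ^ m)" by (rule rational_comp[OF A(1) Am])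
  then interpret Am: nonconstant_rational "A \<circ> A ^^ m" "n * n ^ m" using A(2) by unfold_locales auto
  have "\<not> (\<exists>\<^sub>\<infinity>w. h w = (A ^^ m) w)" using rational_eqI[OF h(1) Am] False by blast
  then have ne: "\<forall>\<^sub>\<infinity>w. \<forall>w'. A w' = A w \<longrightarrow> h w' \<noteq> (A ^^ m) w'"
    by (intro A.MOST_same_fibre) simp
  have Am_fibre: "(A ^^ m) w' = (A ^^ m) w" if "A w' = A w" for w w'
    using that h(3) by (cases m) (simp_all add: funpow_swap1)
  have "\<exists>\<^sub>\<infinity>w. \<exists>w'. w' \<noteq> w \<and> A w' = A w \<and> h w' = h w"
  proof (rule ccontr)
    assume "\<not> ?thesis"
    then have inj: "\<forall>\<^sub>\<infinity>w. \<forall>w'. A w' = A w \<longrightarrow> \<not> (\<exists>w''. w'' \<noteq> w' \<and> A w'' = A w' \<and> h w'' = h w')"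
      by (intro A.MOST_same_fibre) simp
    obtain w where ne: "\<forall>w'. A w' = A w \<longrightarrow> h w' \<noteq> (A ^^ m) w'"
      and inj: "\<forall>w'. A w' = A w \<longrightarrow> \<not> (\<exists>w''. w'' \<noteq> w' \<and> A w'' = A w' \<and> h w'' = h w')"
      and card: "card (A -` {A w}) = n" "card (A -` {(A \<circ> A ^^ m) w}) = n"
      using MOST_cp1_ex[OF MOST_conjI[OF MOST_conjI[OF ne inj]
            MOST_conjI[OF A.MOST_vimage[OF A.MOST_card_fibre] Am.MOST_vimage[OF A.MOST_card_fibre]]]]
      by blast
    have "inj_on h (A -` {A w})" using inj by (intro inj_onI) (metis vimage_singleton_eq)
    moreover have "h ` (A -` {A w}) \<subseteq> A -` {(A \<circ> A ^^ m) w} - {(A ^^ m) w}"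
    proof
      fix t assume "t \<in> h ` (A -` {A w})"
      then obtain w' where w': "t = h w'" "A w' = A w" by auto
      have "A (h w') = A ((A ^^ m) w')" using h(2) by (metis comp_apply)
      then show "t \<in> A -` {(A \<circ> A ^^ m) w} - {(A ^^ m) w}"
        using ne w' Am_fibre[OF w'(2)] by auto
    qed
    ultimately have "card (A -` {A w}) \<le> card (A -` {(A \<circ> A ^^ m) w} - {(A ^^ m) w})"
      using card_inj_on_le[of h] A.finite_fibre by blast
    also have "\<dots> < card (A -` {(A \<circ> A ^^ m) w})"
      by (intro psubset_card_mono A.finite_fibre) auto
    finally show False using card by simp
  qed
  then obtain W d a k b j where W: "rational_of_degree W d" "d \<ge> 2"
    and a: "rational_of_degree a k" "A = a \<circ> W" and b: "rational_of_degree b j" "h = b \<circ> W"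
    using lueroth[OF A(1) A.pos h(1)] by blast
  \<comment> \<open>Once \<open>a\<close> is invertible, \<open>W\<close> factors through
    \<open>A\<close>, and with it \<open>h\<close>.\<close>
  have "moebius a" by (rule indecomposable_left_factor[OF A a(2,1) W])
  then obtain a' where a': "moebius a'" "a' \<circ> a = id" using moebius_inverse by metis
  then have "h = (b \<circ> a') \<circ> A" unfolding a(2) b(2) by (metis comp_assoc comp_id)
  then show ?thesis using rational_comp[OF b(1)] a'(1) moebius_iff_rational by blast
qed

text \<open>Each step writes \<open>h = g \<circ> A\<close> and cancels \<open>A\<close> on the
  right by surjectivity, which lowers the exponent by one.\<close>

lemma indecomposable_funpow_cancel:
  assumes A: "rational_of_degree A n" "n \<ge> 2" "indecomposable A"
    and h: "rational_of_degree h l" "A \<circ> A ^^ m = A \<circ> h"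
  shows "\<exists>\<nu> k. rational_of_degree \<nu> k \<and> h = \<nu> \<circ> A ^^ m"
  using h
proof (induction m arbitrary: h l)
  case 0
  then show ?case by (metis comp_id funpow_0 eq_id_iff)
next
  case (Suc m)
  interpret A: nonconstant_rational A n using A by unfold_locales auto
  obtain g k where g: "rational_of_degree g k" "h = g \<circ> A"
    using indecomposable_right_factor[OF A Suc.prems] by auto
  have "(A \<circ> A ^^ m) \<circ> A = (A \<circ> g) \<circ> A"
    using Suc.prems(2) g(2) by (simp only: funpow_Suc_right comp_assoc)
  then have "A \<circ> A ^^ m = A \<circ> g" by (rule surj_comp_cancel[OF A.surj])
  then obtain \<nu> k where "rational_of_degree \<nu> k" "g = \<nu> \<circ> A ^^ m"
    using Suc.IH[OF g(1)] by blast
  then show ?case using g(2) by (metis comp_assoc funpow_Suc_right)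
qed

lemma Sigma_grp_funpow_trivial:
  assumes A: "rational_of_degree A n" "n \<ge> 2" "indecomposable A" and triv: "Sigma_grp A = {id}"
  shows "Sigma_grp (A ^^ Suc k) = {id}"
proof (induction k)
  case 0
  then show ?case using triv by (simp only: funpow.simps comp_id)
next
  case (Suc k)
  interpret A: nonconstant_rational A n using A by unfold_locales auto
  define m where "m = Suc k"
  have Am: "rational_of_degree (A ^^ m) (n ^ m)" by (rule rational_funpow[OF A(1)])
  interpret Am: nonconstant_rational "A ^^ m" "n ^ m" using Am A(2) by unfold_locales auto
  have "\<sigma> = id" if "\<sigma> \<in> Sigma_grp (A ^^ Suc m)" for \<sigma>
  proof -
    have \<sigma>: "moebius \<sigma>" "A ^^ Suc m \<circ> \<sigma> = A ^^ Suc m" using that by (auto simp: Sigma_grp_def)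
    then have eq: "A \<circ> A ^^ m = A \<circ> (A ^^ m \<circ> \<sigma>)" by (simp add: comp_assoc)
    have "rational_of_degree (A ^^ m \<circ> \<sigma>) (n ^ m)"
      using rational_comp[OF Am] \<sigma>(1) by (metis moebius_iff_rational mult_1_right)
    from indecomposable_funpow_cancel[OF A this eq]
    obtain \<nu> j where \<nu>: "rational_of_degree \<nu> j" "A ^^ m \<circ> \<sigma> = \<nu> \<circ> A ^^ m" by blast
    then have "(A \<circ> \<nu>) \<circ> A ^^ m = A \<circ> A ^^ m" using eq by (simp add: comp_assoc)
    then have "A \<circ> \<nu> = A" by (rule surj_comp_cancel[OF Am.surj])
    \<comment> \<open>Comparing degrees forces \<open>j = 1\<close>, so that \<open>\<nu>\<close> is
      Moebius and falls under the hypothesis on \<open>Sigma_grp A\<close>.\<close>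
    moreover from this have "n * j = n"
      using rational_comp[OF A(1) \<nu>(1)] A(1) rational_degree_unique by metis
    then have "moebius \<nu>" using \<nu>(1) A(2) by (simp add: moebius_iff_rational)
    ultimately have "\<nu> = id" using triv by (auto simp: Sigma_grp_def)
    then have "\<sigma> \<in> Sigma_grp (A ^^ m)" using \<nu>(2) \<sigma>(1) by (simp add: Sigma_grp_def)
    then show ?thesis using Suc unfolding m_def by blast
  qed
  moreover have "id \<in> Sigma_grp (A ^^ Suc m)" using moebius_id by (simp add: Sigma_grp_def)
  ultimately show ?case unfolding m_def by blast
qed

subsection \<open>Maps invariant under a Moebius transformation\<close>

text \<open>The fixed-point equation is quadratic unless \<open>c = 0\<close>, and then infinity is
  fixed.\<close>

lemma moebius_fixed_point:
  assumes "moebius \<sigma>"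
  shows "\<exists>w. \<sigma> w = w"
proof -
  obtain a b c d where det: "a * d - b * c \<noteq> 0" and \<sigma>: "\<sigma> = quot_map [:b, a:] [:d, c:]"
    using assms unfolding moebius_def by blast
  show ?thesis
  proof (cases "c = 0")
    case True
    then have "\<sigma> None = None" using det moebius_hom_point[OF det, of 1 0] by (simp add: \<sigma> hom_point_def)
    then show ?thesis by blast
  next
    case False
    then have "degree [:- b, d - a, c:] \<noteq> 0" by simp
    then obtain z where "poly [:- b, d - a, c:] z = 0" using degree_0_or_root[of "[:- b, d - a, c:]"] by metis
    then have z: "a * z + b = z * (c * z + d)" by (simp add: algebra_simps)
    have "(a * z + b, c * z + d) \<noteq> (0, 0)"
    proof
      assume "(a * z + b, c * z + d) = (0, 0)"
      then have "b = - (a * z)" "d = - (c * z)" by (simp_all add: add_eq_0_iff2 algebra_simps)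
      then show False using det by simp
    qed
    \<comment> \<open>If the denominator vanished, the fixed-point equation would make the numerator
      vanish as well.\<close>
    then have "c * z + d \<noteq> 0" using z by auto
    then have "\<sigma> (hom_point z 1) = Some z"
      using moebius_hom_point[OF det, of z 1] z by (simp add: \<sigma> hom_point_def)
    then show ?thesis by (auto simp: hom_point_def)
  qed
qed

lemma ex_moebius_None:
  obtains \<mu> where "moebius \<mu>" "\<mu> None = w"
proof (cases w)
  case None
  then show ?thesis using that[OF moebius_id] by simp
next
  case (Some s)
  \<comment> \<open>The map \<open>z \<mapsto> s + 1 / z\<close>.\<close>
  have "moebius (quot_map [:1, s:] [:0, 1:])"
    unfolding moebius_def by (intro exI[of _ s] exI[of _ 1] exI[of _ 0]) auto
  moreover have "quot_map [:1, s:] [:0, 1:] None = w"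
    using moebius_hom_point[of s 0 1 1 1 0] Some by (simp add: hom_point_def)
  ultimately show ?thesis by (rule that)
qed

lemma moebius_fixing_None:
  assumes "moebius \<sigma>" "\<sigma> None = None"
  obtains \<alpha> \<beta> where "\<alpha> \<noteq> 0" "\<sigma> = quot_map [:\<beta>, \<alpha>:] 1"
proof -
  obtain a b c d where det: "a * d - b * c \<noteq> 0" and \<sigma>: "\<sigma> = quot_map [:b, a:] [:d, c:]"
    using assms(1) unfolding moebius_def by blast
  have c: "c = 0"
    using assms(2) moebius_hom_point[OF det, of 1 0] by (simp add: \<sigma> hom_point_def split: if_splits)
  then have ad: "a \<noteq> 0" "d \<noteq> 0" using det by auto
  have "\<sigma> w = quot_map [:b / d, a / d:] 1 w" for w
  proof (cases w)
    case None
    then show ?thesis using assms(2) ad by (simp add: affine_None)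
  next
    case (Some z)
    then show ?thesis unfolding Some affine_Some
      using ad by (simp add: \<sigma> quot_map_Some hom_point_def c field_simps)
  qed
  then have "\<sigma> = quot_map [:b / d, a / d:] 1" by blast
  then show ?thesis using that[of "a / d"] ad by simp
qed

text \<open>An orbit of a symmetry of \<open>F\<close> lies in a single finite fibre and must
  repeat. This excludes translations and rotations of infinite order.\<close>

lemma (in nonconstant_rational) finite_invariant_orbit:
  assumes "\<And>i::nat. F (Some (x i)) = F (Some (x 0))"
  shows "\<not> inj x"
proof
  assume "inj x"
  then have "infinite (range (\<lambda>i. Some (x i)))"
    by (intro range_inj_infinite) (auto simp: inj_def)
  moreover have "range (\<lambda>i. Some (x i)) \<subseteq> F -` {F (Some (x 0))}" using assms by auto
  ultimately show False using finite_fibre finite_subset by blast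
qed

text \<open>Moving a fixed point to infinity makes \<open>\<sigma>\<close> affine. A nontrivial
  translation has infinite orbits and is impossible; otherwise there is a finite fixed point, which
  is moved to the origin.\<close>

lemma Sigma_grp_rotation:
  assumes A: "rational_of_degree A n" "n \<ge> 1" and \<sigma>: "\<sigma> \<in> Sigma_grp A" "\<sigma> \<noteq> id"
  obtains \<mu> \<alpha> where "moebius \<mu>" "\<alpha> \<noteq> 0" "\<alpha> \<noteq> 1" "\<And>z. A (\<mu> (Some (\<alpha> * z))) = A (\<mu> (Some z))"
proof -
  have m\<sigma>: "moebius \<sigma>" "A \<circ> \<sigma> = A" using \<sigma>(1) by (auto simp: Sigma_grp_def)
  obtain w where w: "\<sigma> w = w" using moebius_fixed_point[OF m\<sigma>(1)] by blast
  obtain \<mu> where \<mu>: "moebius \<mu>" "\<mu> None = w" using ex_moebius_None .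
  obtain \<mu>' where \<mu>': "moebius \<mu>'" "\<mu> \<circ> \<mu>' = id" "\<mu>' \<circ> \<mu> = id" using moebius_inverse[OF \<mu>(1)] .
  define \<tau> where "\<tau> = \<mu>' \<circ> \<sigma> \<circ> \<mu>"
  have "moebius \<tau>" unfolding \<tau>_def using \<mu> \<mu>' m\<sigma> by (intro moebius_comp)
  moreover have "\<tau> None = None" using \<mu>'(3) \<mu>(2) w by (metis \<tau>_def comp_apply id_apply)
  ultimately obtain \<alpha> \<beta> where \<alpha>: "\<alpha> \<noteq> 0" and \<tau>: "\<tau> = quot_map [:\<beta>, \<alpha>:] 1"
    using moebius_fixing_None by metis
  have conj: "\<mu> \<circ> \<tau> = \<sigma> \<circ> \<mu>" unfolding \<tau>_def by (metis \<mu>'(2) comp_assoc id_comp)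
  define B where "B = A \<circ> \<mu>"
  have "rational_of_degree B n"
    using rational_comp[OF A(1)] \<mu>(1) unfolding B_def by (metis moebius_iff_rational mult_1_right)
  then interpret B: nonconstant_rational B n using A by unfold_locales
  have "B \<circ> \<tau> = B" unfolding B_def using conj m\<sigma>(2) by (metis comp_assoc)
  then have inv: "B (Some (\<alpha> * z + \<beta>)) = B (Some z)" for z
    by (metis affine_Some \<tau> comp_apply)
  have "\<alpha> \<noteq> 1"
  proof
    assume "\<alpha> = 1"
    have "\<beta> \<noteq> 0"
    proof
      assume "\<beta> = 0"
      have "\<tau> v = v" for v
        by (cases v) (simp_all add: \<tau> \<open>\<alpha> = 1\<close> \<open>\<beta> = 0\<close> affine_Some affine_None)
      then have "\<tau> = id" by auto
      then have "\<sigma> \<circ> \<mu> = \<mu>" using conj by simp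
      then have "\<sigma> = id" using \<mu>'(2) by (metis comp_assoc comp_id)
      then show False using \<sigma>(2) by simp
    qed
    have "B (Some (of_nat i * \<beta>)) = B (Some 0)" for i
    proof (induction i)
      case (Suc i)
      then show ?case using inv[of "of_nat i * \<beta>"] by (simp add: \<open>\<alpha> = 1\<close> algebra_simps)
    qed simp
    then have "\<not> inj (\<lambda>i. of_nat i * \<beta>)" by (intro B.finite_invariant_orbit) simp
    then show False using \<open>\<beta> \<noteq> 0\<close> by (auto simp: inj_def)
  qed
  \<comment> \<open>The finite fixed point of
    \<open>z \<mapsto> \<alpha> * z + \<beta>\<close>.\<close>
  define s where "s = \<beta> / (1 - \<alpha>)"
  have s: "\<alpha> * s + \<beta> = s" using \<open>\<alpha> \<noteq> 1\<close> by (simp add: s_def field_simps)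
  define \<mu>2 where "\<mu>2 = quot_map [:s, 1:] 1"
  have "A ((\<mu> \<circ> \<mu>2) (Some (\<alpha> * z))) = A ((\<mu> \<circ> \<mu>2) (Some z))" for z
  proof -
    have "A ((\<mu> \<circ> \<mu>2) (Some (\<alpha> * z))) = B (Some (\<alpha> * z + s))"
      using affine_Some[of s 1] by (simp add: B_def \<mu>2_def)
    also have "\<alpha> * z + s = \<alpha> * (z + s) + \<beta>" using s by (simp add: algebra_simps)
    also have "B (Some \<dots>) = B (Some (z + s))" by (rule inv)
    also have "\<dots> = A ((\<mu> \<circ> \<mu>2) (Some z))"
      using affine_Some[of s 1] by (simp add: B_def \<mu>2_def)
    finally show ?thesis .
  qed
  moreover have "moebius (\<mu> \<circ> \<mu>2)" unfolding \<mu>2_def by (intro moebius_comp \<mu> moebius_affine) simp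
  ultimately show ?thesis using that \<alpha> \<open>\<alpha> \<noteq> 1\<close> by blast
qed

section \<open>Power maps and roots of unity\<close>

lemma pow_map_Some: "pow_map r (Some z) = Some (z ^ r)"
  by (simp add: pow_map_def quot_map_Some hom_point_def poly_monom)

lemma pow_map_None: "r \<ge> 1 \<Longrightarrow> pow_map r None = None"
  by (simp add: pow_map_def quot_map_None hom_point_def degree_monom_eq)

lemma rational_pow_map: "rational_of_degree (pow_map r) r"
  unfolding rational_of_degree_def pow_map_def
  by (intro exI[of _ "monom 1 r"] exI[of _ 1]) (simp add: degree_monom_eq)

text \<open>The powers of \<open>\<alpha>\<close> with exponent below its order \<open>r\<close> are
  distinct, so they exhaust the \<open>r\<close> roots of unity.\<close>

lemma root_of_unity_powers:
  fixes \<alpha> :: complex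
  assumes "r \<ge> 1" "\<alpha> ^ r = 1" "\<And>j. 1 \<le> j \<Longrightarrow> j < r \<Longrightarrow> \<alpha> ^ j \<noteq> 1" and y: "y ^ r = 1"
  shows "\<exists>i. y = \<alpha> ^ i"
proof -
  have "\<alpha> \<noteq> 0" using assms(1,2) by (auto simp: power_0_left)
  have ne: "\<alpha> ^ i \<noteq> \<alpha> ^ j" if "i < j" "j < r" for i j
  proof
    assume "\<alpha> ^ i = \<alpha> ^ j"
    also have "\<dots> = \<alpha> ^ i * \<alpha> ^ (j - i)" using that by (simp flip: power_add)
    finally have "\<alpha> ^ (j - i) = 1" using \<open>\<alpha> \<noteq> 0\<close> by simp
    then show False using assms(3)[of "j - i"] that by simp
  qed
  have "inj_on (\<lambda>i. \<alpha> ^ i) {..<r}" by (intro linorder_inj_onI) (use ne in auto)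
  then have "card ((\<lambda>i. \<alpha> ^ i) ` {..<r}) = r" by (simp add: card_image)
  moreover have "card {z::complex. z ^ r = 1} = r" using assms(1) by (intro card_roots_unity_eq) auto
  moreover have "finite {z::complex. z ^ r = 1}" using assms(1) by (intro finite_roots_unity)
  moreover have "(\<lambda>i. \<alpha> ^ i) ` {..<r} \<subseteq> {z. z ^ r = 1}"
    using assms(2) by (auto simp flip: power_mult simp: mult.commute[of _ r]) (simp add: power_mult)
  ultimately have "(\<lambda>i. \<alpha> ^ i) ` {..<r} = {z. z ^ r = 1}" by (intro card_subset_eq) auto
  then show ?thesis using y by blast
qed

text \<open>Invariance under a rotation makes \<open>A\<close> equivalent to a power map, so it has all
  the symmetries that come from \<open>z \<mapsto> c * z\<close>.\<close>

lemma G_hat_nontrivial: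
  assumes A: "rational_of_degree A n" "n \<ge> 2" "indecomposable A" and \<sigma>: "\<sigma> \<in> Sigma_grp A" "\<sigma> \<noteq> id"
  shows "G_hat A \<noteq> {id}"
proof
  assume triv: "G_hat A = {id}"
  interpret A: nonconstant_rational A n using A by unfold_locales auto
  obtain \<mu> \<alpha> where \<mu>: "moebius \<mu>" and \<alpha>: "\<alpha> \<noteq> 0" "\<alpha> \<noteq> 1"
    and inv: "\<And>z. A (\<mu> (Some (\<alpha> * z))) = A (\<mu> (Some z))"
    using Sigma_grp_rotation[OF A(1) A.pos \<sigma>] by metis
  define C where "C = A \<circ> \<mu>"
  have C: "rational_of_degree C n"
    using rational_comp[OF A(1)] \<mu>(1) unfolding C_def by (metis moebius_iff_rational mult_1_right)
  then interpret C: nonconstant_rational C n using A.pos by unfold_locales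
  have pow: "C (Some (\<alpha> ^ i * z)) = C (Some z)" for i z
    by (induction i) (use inv[of "\<alpha> ^ _ * z"] in \<open>simp_all add: C_def mult.assoc\<close>)
  \<comment> \<open>The orbit of \<open>1\<close> lies in one fibre, so \<open>\<alpha>\<close> is a
    root of unity; \<open>r\<close> will be its order.\<close>
  have "\<not> inj (\<lambda>i. \<alpha> ^ i)" using pow[of _ 1] by (intro C.finite_invariant_orbit) simp
  then obtain i j where "\<alpha> ^ i = \<alpha> ^ j" "i < j" unfolding inj_def by (metis linorder_neqE_nat)
  moreover from this(2) have "\<alpha> ^ j = \<alpha> ^ i * \<alpha> ^ (j - i)" by (simp flip: power_add)
  ultimately have "\<alpha> ^ i = \<alpha> ^ i * \<alpha> ^ (j - i)" by simp
  then have ex: "1 \<le> j - i \<and> \<alpha> ^ (j - i) = 1" using \<alpha>(1) \<open>i < j\<close> by simp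
  define r where "r = (LEAST r. 1 \<le> r \<and> \<alpha> ^ r = 1)"
  have r: "1 \<le> r" "\<alpha> ^ r = 1" using LeastI[of "\<lambda>r. 1 \<le> r \<and> \<alpha> ^ r = 1", OF ex] by (auto simp: r_def)
  have least: "\<alpha> ^ l \<noteq> 1" if "1 \<le> l" "l < r" for l
    using not_less_Least[of l "\<lambda>r. 1 \<le> r \<and> \<alpha> ^ r = 1"] that by (auto simp: r_def)
  have "r \<noteq> 1" using r(2) \<alpha>(2) by auto
  then have "r \<ge> 2" using r(1) by simp
  define W where "W = pow_map r"
  have W: "rational_of_degree W r" unfolding W_def by (rule rational_pow_map)
  interpret W: nonconstant_rational W r using W r(1) by unfold_locales
  have "\<forall>\<^sub>\<infinity>w. \<forall>w'. W w' = W w \<longrightarrow> C w' = C w"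
    unfolding MOST_option_iff
  \<comment> \<open>Away from \<open>0\<close>, points with the same \<open>r\<close>-th power
    differ by a power of \<open>\<alpha>\<close>, under which \<open>C\<close> is invariant.\<close>
  proof (rule MOST_mono[OF MOST_neq(1)[of 0]], intro allI impI)
    fix z :: complex and w' assume "z \<noteq> 0" and w': "W w' = W (Some z)"
    then obtain z' where z': "w' = Some z'"
      using pow_map_None[OF r(1)] by (cases w') (auto simp: W_def pow_map_Some)
    then have "(z' / z) ^ r = 1" using w' \<open>z \<noteq> 0\<close> by (simp add: W_def pow_map_Some power_divide)
    then obtain k where "z' / z = \<alpha> ^ k" using root_of_unity_powers[OF r least] by blast
    then have "z' = \<alpha> ^ k * z" using \<open>z \<noteq> 0\<close> by (simp add: field_simps)
    then show "C w' = C (Some z)" using pow by (simp add: z')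
  qed
  from W.ex_left_factor[OF C this] obtain Q k where Q: "rational_of_degree Q k" "C = Q \<circ> W" by blast
  obtain \<mu>' where \<mu>': "moebius \<mu>'" "\<mu> \<circ> \<mu>' = id" "\<mu>' \<circ> \<mu> = id" using moebius_inverse[OF \<mu>] .
  have A_eq: "A = Q \<circ> (W \<circ> \<mu>')"
    using Q(2) \<mu>'(2) unfolding C_def by (metis comp_assoc comp_id)
  have W': "rational_of_degree (W \<circ> \<mu>') r"
    using rational_comp[OF W] \<mu>'(1) by (metis moebius_iff_rational mult_1_right)
  have mQ: "moebius Q" by (rule indecomposable_left_factor[OF A A_eq Q(1) W' \<open>r \<ge> 2\<close>])
  obtain Q' where Q': "moebius Q'" "Q \<circ> Q' = id" "Q' \<circ> Q = id" using moebius_inverse[OF mQ] .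
  \<comment> \<open>Scaling by \<open>2\<close> passes through the power map as scaling by
    \<open>2 ^ r\<close>, which is not the identity.\<close>
  define S S' where "S = quot_map [:0, 2:] 1" and "S' = quot_map [:0, 2 ^ r:] 1"
  have S: "moebius S" "moebius S'" unfolding S_def S'_def by (intro moebius_affine; simp)+
  have "(W \<circ> S) w = (S' \<circ> W) w" for w
  proof (cases w)
    case None
    then show ?thesis
      by (simp add: W_def S_def S'_def pow_map_None[OF r(1)] affine_None del: one_pCons)
  next
    case (Some z)
    then show ?thesis
      by (simp add: W_def S_def S'_def pow_map_Some affine_Some power_mult_distrib)
  qed
  then have WS: "W \<circ> S = S' \<circ> W" by blast
  define \<tau> \<nu> where "\<tau> = \<mu> \<circ> S \<circ> \<mu>'" and "\<nu> = Q \<circ> S' \<circ> Q'"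
  have \<tau>: "moebius \<tau>" and \<nu>: "moebius \<nu>"
    unfolding \<tau>_def \<nu>_def using S \<mu> \<mu>' mQ Q' by (auto intro!: moebius_comp)
  have "A \<circ> \<tau> = Q \<circ> W \<circ> (\<mu>' \<circ> \<mu>) \<circ> S \<circ> \<mu>'" unfolding A_eq \<tau>_def by (simp add: comp_assoc)
  also have "\<dots> = Q \<circ> (W \<circ> S) \<circ> \<mu>'" unfolding \<mu>'(3) by (simp add: comp_assoc)
  also have "\<dots> = Q \<circ> S' \<circ> (Q' \<circ> Q) \<circ> W \<circ> \<mu>'" unfolding WS Q'(3) by (simp add: comp_assoc)
  also have "\<dots> = \<nu> \<circ> A" unfolding A_eq \<nu>_def by (simp add: comp_assoc)
  finally have eq: "A \<circ> \<tau> = \<nu> \<circ> A" .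
  have "nu_map A \<tau> = \<nu>"
    unfolding nu_map_def using \<nu> eq surj_comp_cancel[OF A.surj] by (intro the_equality) auto
  moreover have "\<tau> \<in> G_grp A" using \<tau> \<nu> eq unfolding G_grp_def by blast
  ultimately have "\<nu> = id" using triv unfolding G_hat_def by blast
  \<comment> \<open>Undoing the conjugation by \<open>Q\<close> would make \<open>S'\<close> the
    identity.\<close>
  then have "Q \<circ> S' \<circ> (Q' \<circ> Q) = Q" unfolding \<nu>_def by (metis comp_assoc id_comp)
  then have "Q' \<circ> Q \<circ> S' = Q' \<circ> Q" using Q'(3) by (metis comp_assoc comp_id)
  then have "S' (Some 1) = Some 1" unfolding Q'(3) by (metis comp_apply id_apply)
  then have "(2::complex) ^ r = 1" by (simp add: S'_def affine_Some)
  then have "norm ((2::complex) ^ r) = 1" by simp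
  then have "(2::real) ^ r = 1" by (simp add: norm_power)
  then show False using r(1) one_less_power[of "2::real" r] by simp
qed

section \<open>Conclusion under each of the two hypotheses\<close>

theorem theorem1p4:
  fixes A :: "cp1 \<Rightarrow> cp1" and n :: nat
  assumes "rational_of_degree A n" and "n \<ge> 2"
    and "indecomposable A"
    and "\<not> conjugate A (pow_map n)" and "\<not> conjugate A (inv_pow_map n)"
  shows "(G_hat A = {id} \<longrightarrow> Sigma_inf A = Sigma_grp A) \<and>
         (G_grp A = Aut_grp A \<longrightarrow> Sigma_inf A = {id})"
proof -
  note A = assms(1-3)
  interpret A: nonconstant_rational A n using A by unfold_locales auto
  have id: "id \<in> Sigma_grp A" using moebius_id by (simp add: Sigma_grp_def)
  have inf: "Sigma_inf A = {id}" if "Sigma_grp A = {id}"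
  proof -
    have "Sigma_grp (A ^^ k) = {id}" if "k \<in> {1..}" for k
    proof -
      obtain j where "k = Suc j" using \<open>k \<in> {1..}\<close> by (cases k) auto
      then show ?thesis using Sigma_grp_funpow_trivial[OF A \<open>Sigma_grp A = {id}\<close>] by metis
    qed
    then show ?thesis unfolding Sigma_inf_def by auto
  qed
  have "Sigma_grp A = {id}" if "G_hat A = {id}"
    using G_hat_nontrivial[OF A] that id by blast
  moreover have "Sigma_grp A = {id}" if G: "G_grp A = Aut_grp A"
  proof -
    have "\<sigma> = id" if \<sigma>: "\<sigma> \<in> Sigma_grp A" for \<sigma>
    proof -
      \<comment> \<open>Membership is witnessed by \<open>\<nu> = id\<close>; commutation with
        \<open>A\<close> then lets surjectivity of \<open>A\<close> identify \<open>\<sigma>\<close>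
        with \<open>id\<close>.\<close>
      have "\<sigma> \<in> G_grp A"
        using \<sigma> moebius_id unfolding Sigma_grp_def G_grp_def
        by (metis (mono_tags, lifting) id_comp mem_Collect_eq)
      then have "\<sigma> \<circ> A = id \<circ> A" using \<sigma> G by (auto simp: Aut_grp_def Sigma_grp_def)
      then show ?thesis by (rule surj_comp_cancel[OF A.surj])
    qed
    then show ?thesis using id by blast
  qed
  ultimately show ?thesis using inf by auto
qed

end
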